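(* Let $Q$ be a compact metric space, let $\mu$ be a Borel probability measure on $Q$, and let $X_m$ be an $m$-dimensional linear subspace of $C(Q)$. Let $\Sigma\subset M(Q)$ be the set of all probability measures $\rho$ on $Q$ of the form $\rho=\sum_{j=1}^{m+2}\lambda_j(\rho)\,\delta_{y_j(\rho)}$ with $\lambda_j(\rho)\ge 0$, $y_j(\rho)\in Q$ for $1\le j\le m+2$, $\sum_{j=1}^{m+2}\lambda_j(\rho)=1$, and such that $\int_Q f\,d\mu=\int_Q f\,d\rho$ for all $f\in X_m$. Then there exists a Borel probability measure $\nu$ on $M(Q)^{w^*}$ which is supported in $\Sigma$ and satisfies $\mu=\int_\Sigma \rho\,d\nu(\rho)$ in the sense that for every $f\in C(Q)$, $$\int_Q f(x)\,d\mu(x)=\int_\Sigma \sum_{j=1}^{m+2}\lambda_j(\rho)\,f(y_j(\rho))\,d\nu(\rho).$$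
   Context: $C(Q)$ is the space of real continuous functions on $Q$ with the uniform norm. $M(Q)$ is the space of finite signed Borel measures on $Q$ with the total variation norm, identified with the dual of $C(Q)$; $M(Q)^{w^*}$ denotes $M(Q)$ with the weak* topology. $\delta_y$ is the Dirac measure at $y$. Note that $\sum_{j=1}^{m+2}\lambda_j(\rho) f(y_j(\rho))=\int_Q f\,d\rho$ depends only on $\rho$ and not on the chosen representation. *)

theory Defs
  imports "HOL-Probability.Probability"
begin

text \<open>
  The space $Q$ is a type of class \<^class>\<open>metric_space\<close> with compact universe. Then every
  continuous function on it is bounded, so the type of bounded continuous functions
  is $C(Q)$ with the uniform norm.
\<close>

definition signed_measures :: "('a::topological_space set \<Rightarrow> real) set" where
  "signed_measures = {s. s {} = 0 \<and>
     (\<forall>A. range A \<subseteq> sets borel \<longrightarrow> disjoint_family A \<longrightarrow>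
        (\<lambda>i::nat. s (A i)) sums s (\<Union>i. A i)) \<and>
     \<comment> \<open>the value on non-Borel sets is fixed so that equality of functions is equality of measures\<close>
     (\<forall>A. A \<notin> sets borel \<longrightarrow> s A = 0)}"

text \<open>
  Positive part of the Jordan decomposition: the measure whose value at $A$ is the supremum of
  $s(B)$ over Borel $B \subseteq A$. Since $B = \emptyset$ is allowed, the truncation of negative
  values by \<^const>\<open>ennreal\<close> does not change the supremum.
\<close>

definition pos_part :: "('a::topological_space set \<Rightarrow> real) \<Rightarrow> 'a measure" where
  "pos_part s = measure_of UNIV (sets borel) (\<lambda>A. SUP B\<in>{B \<in> sets borel. B \<subseteq> A}. ennreal (s B))"

definition neg_part :: "('a::topological_space set \<Rightarrow> real) \<Rightarrow> 'a measure" where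
  "neg_part s = pos_part (\<lambda>A. - s A)"

definition signed_integral :: "('a::topological_space set \<Rightarrow> real) \<Rightarrow> ('a \<Rightarrow> real) \<Rightarrow> real" where
  "signed_integral s f = (\<integral>x. f x \<partial>pos_part s) - (\<integral>x. f x \<partial>neg_part s)"

definition weak_star_topology :: "('a::metric_space set \<Rightarrow> real) topology" where
  "weak_star_topology = topology_generated_by
     {{s \<in> signed_measures. signed_integral s (apply_bcontfun f) \<in> U} | (f :: 'a \<Rightarrow>\<^sub>C real) U. open U}"

definition weak_star_borel :: "('a::metric_space set \<Rightarrow> real) measure" where
  "weak_star_borel = sigma signed_measures {U. openin weak_star_topology U}"

text \<open>
  A finite measure \<open>N\<close> on the Borel sets is the element \<open>measure N\<close> of \<^const>\<open>signed_measures\<close>;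
  \<^const>\<open>measure\<close> vanishes outside the sigma-algebra. In particular the Dirac measure at \<open>y\<close>
  is \<open>measure (return borel y)\<close>.
\<close>

definition convex_dirac_combination ::
    "nat \<Rightarrow> (nat \<Rightarrow> real) \<Rightarrow> (nat \<Rightarrow> 'a::topological_space) \<Rightarrow> ('a set \<Rightarrow> real) \<Rightarrow> bool" where
  "convex_dirac_combination n lam y \<rho> \<longleftrightarrow>
     (\<forall>j\<in>{1..n}. 0 \<le> lam j) \<and> (\<Sum>j=1..n. lam j) = 1 \<and>
     \<rho> = (\<lambda>A. \<Sum>j=1..n. lam j * measure (return borel (y j)) A)"

definition quadrature_measures ::
    "'a::metric_space measure \<Rightarrow> ('a \<Rightarrow>\<^sub>C real) set \<Rightarrow> nat \<Rightarrow> ('a set \<Rightarrow> real) set" where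
  "quadrature_measures \<mu> X m = {\<rho> \<in> signed_measures.
     (\<forall>A\<in>sets borel. 0 \<le> \<rho> A) \<and> \<rho> UNIV = 1 \<and>
     (\<exists>lam y. convex_dirac_combination (m + 2) lam y \<rho>) \<and>
     (\<forall>f\<in>X. (\<integral>x. apply_bcontfun f x \<partial>\<mu>) = signed_integral \<rho> (apply_bcontfun f))}"

lemma topspace_weak_star_topology [simp]:
  "topspace (weak_star_topology :: ('a::metric_space set \<Rightarrow> real) topology) = signed_measures"
proof -
  have "signed_measures \<in> {{s \<in> signed_measures. signed_integral s (apply_bcontfun f) \<in> U} |
          (f :: 'a \<Rightarrow>\<^sub>C real) U. open U}"
    by (intro CollectI exI[of _ "0 :: 'a \<Rightarrow>\<^sub>C real"] exI[of _ UNIV]) auto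
  then show ?thesis
    unfolding weak_star_topology_def topology_generated_by_topspace by blast
qed

lemma space_weak_star_borel [simp]: "space weak_star_borel = signed_measures"
  unfolding weak_star_borel_def
  by (rule space_measure_of) (use openin_subset in fastforce)

lemma measure_in_signed_measures:
  fixes N :: "'a::topological_space measure"
  assumes "finite_measure N" and "sets N = sets borel"
  shows "measure N \<in> signed_measures"
proof -
  interpret finite_measure N by fact
  show ?thesis
    unfolding signed_measures_def using assms(2)
    by (auto intro!: finite_measure_UNION measure_notin_sets)
qed

lemma signed_integral_measure:
  fixes N :: "'a::topological_space measure"
  assumes "finite_measure N" and "sets N = sets borel"
  shows "signed_integral (measure N) f = (\<integral>x. f x \<partial>N)"
proof -
  interpret finite_measure N by fact
  have spN: "space N = UNIV"
    using sets_eq_imp_space_eq[OF assms(2)] by simp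
  have "pos_part (measure N) = measure_of UNIV (sets borel) (emeasure N)"
    unfolding pos_part_def
  proof (rule measure_of_eq)
    fix A :: "'a set" assume "A \<in> sigma_sets UNIV (sets borel)"
    then have A: "A \<in> sets N"
      using assms(2) by (metis sets.sigma_sets_eq space_borel)
    show "(SUP B\<in>{B \<in> sets borel. B \<subseteq> A}. ennreal (measure N B)) = emeasure N A"
    proof (rule antisym)
      show "(SUP B\<in>{B \<in> sets borel. B \<subseteq> A}. ennreal (measure N B)) \<le> emeasure N A"
        using A by (intro SUP_least) (auto simp: emeasure_eq_measure[symmetric] intro!: emeasure_mono)
      show "emeasure N A \<le> (SUP B\<in>{B \<in> sets borel. B \<subseteq> A}. ennreal (measure N B))"
        using A assms(2) by (intro SUP_upper2[of A]) (auto simp: emeasure_eq_measure)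
    qed
  qed simp
  also have "\<dots> = N"
    using measure_of_of_measure[of N] by (simp add: spN assms(2))
  finally have pos: "pos_part (measure N) = N" .
  have "neg_part (measure N) = measure_of UNIV (sets borel) (\<lambda>_. 0)"
    unfolding neg_part_def pos_part_def
  proof (rule measure_of_eq)
    fix A :: "'a set"
    have "(SUP B\<in>{B \<in> sets borel. B \<subseteq> A}. ennreal (- measure N B))
        = (SUP B\<in>{B \<in> sets borel. B \<subseteq> A}. 0)"
      by (intro SUP_cong) (auto simp: ennreal_neg)
    also have "\<dots> = 0" by (intro antisym SUP_least) auto
    finally show "(SUP B\<in>{B \<in> sets borel. B \<subseteq> A}. ennreal (- measure N B)) = 0" .
  qed simp
  also have "\<dots> = null_measure borel"
    by (simp add: null_measure_def)
  finally have "(\<integral>x. f x \<partial>neg_part (measure N)) = 0"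
    by simp
  with pos show ?thesis by (simp add: signed_integral_def)
qed

end

theory Submission
  imports Defs
begin

text \<open>
  Push $\mu$ forward under Borel maps $T_n$ of finite range with $d(x, T_n x) < 1/(n+1)$; the images
  $\mu_n$ are finitely supported and converge weakly to $\mu$. Moving a finitely supported measure
  back and forth along a solution of the homogeneous moment equations until an atom disappears writes
  $\mu_n$ as a convex combination of measures with at most $m+1$ atoms and the same moments against
  $X_m$ as $\mu_n$. This is a finitely supported probability measure $p_n$ on the compact metrizable
  set of parameters $(\lambda, y)$. The parameter set is a continuous image of a compact set of reals,
  so Helly's selection theorem gives a weak limit of a subsequence of $p_n$. The mean over $p_n$ of
  the moment defect against $\mu$ tends to zero, so the limit lives on parameters with the exact
  moments of $\mu$; its image under $(\lambda, y) \mapsto \sum_j \lambda_j \delta_{y_j}$ is $\nu$.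
  The set $\Sigma$ is the continuous image of a compact set in a Hausdorff space, hence closed; the
  Hausdorff property rests on the Jordan decomposition of a signed measure.
\<close>

section \<open>Signed measures and the weak* topology\<close>

text \<open>The number of atoms comes from linear algebra: \<open>m\<close> moments and the total
  mass are \<open>m + 1\<close> linear conditions on a weight, so a weight with more atoms can be
  moved both ways without violating them. This argument is run on finitely many atoms, which is why
  \<mu> is discretized; the price is that the discretized moments are not those of \<mu>, so exact
  moments reappear only in the limit. The limit is taken among parameters and not among measures
  because the parameters form one compact metric space for all steps of the discretization, whereas
  the weak* topology on all signed measures is in general not metrizable. Two obligations remain on
  the weak* side. \<Sigma> has to be a Borel set, which is the purpose of proving it closed. The
  integrand of the conclusion has to be measurable for arbitrary choices of weights and nodes, which
  holds because on \<Sigma> it is the evaluation of \<rho> at \<open>f\<close>.\<close>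

lemma signed_measures_sums:
  assumes "s \<in> signed_measures" "range A \<subseteq> sets borel" "disjoint_family A"
  shows "(\<lambda>i::nat. s (A i)) sums s (\<Union>i. A i)"
  using assms unfolding signed_measures_def by blast

lemma signed_measures_empty: "s \<in> signed_measures \<Longrightarrow> s {} = 0"
  unfolding signed_measures_def by blast

lemma signed_measures_notin: "s \<in> signed_measures \<Longrightarrow> A \<notin> sets borel \<Longrightarrow> s A = 0"
  unfolding signed_measures_def by blast

lemma signed_measures_Un:
  assumes s: "s \<in> signed_measures" and A: "A \<in> sets borel" "B \<in> sets borel" "A \<inter> B = {}"
  shows "s (A \<union> B) = s A + s B"
proof -
  have "disjoint_family (binaryset A B)"
    using A(3) by (auto simp: disjoint_family_on_def binaryset_def)
  then have "(\<lambda>i. s (binaryset A B i)) sums s (\<Union>i. binaryset A B i)"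
    using A by (intro signed_measures_sums[OF s]) (auto simp: range_binaryset_eq)
  moreover have "(\<lambda>i. s (binaryset A B i)) sums (s A + s B)"
    using signed_measures_empty[OF s] by (rule binaryset_sums)
  ultimately show ?thesis
    using sums_unique2 by (auto simp: UN_binaryset_eq)
qed

lemma signed_measures_Diff:
  assumes s: "s \<in> signed_measures" and A: "A \<in> sets borel" "B \<in> sets borel" "B \<subseteq> A"
  shows "s (A - B) = s A - s B"
proof -
  have "A - B \<union> B = A" "(A - B) \<inter> B = {}" using A by auto
  then show ?thesis
    using signed_measures_Un[OF s, of "A - B" B] A by simp
qed

lemma signed_measures_uminus:
  assumes "s \<in> signed_measures"
  shows "(\<lambda>A. - s A) \<in> signed_measures"
  using assms unfolding signed_measures_def by (auto intro: sums_minus)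

text \<open>Otherwise there is a set with unbounded values on its subsets (\<open>bad\<close>).
  Cutting a bad set into two pieces of modulus at least 1 leaves one of them bad; keeping a bad
  piece each time discards a disjoint sequence whose values do not tend to 0, against countable
  additivity.\<close>

lemma signed_measures_bounded:
  assumes s: "s \<in> signed_measures"
  shows "\<exists>C. \<forall>B\<in>sets borel. \<bar>s B\<bar> \<le> C"
proof (rule ccontr)
  assume unb: "\<not> ?thesis"
  define bad where
    "bad A \<longleftrightarrow> A \<in> sets borel \<and> \<not> (\<exists>C. \<forall>B\<in>sets borel. B \<subseteq> A \<longrightarrow> \<bar>s B\<bar> \<le> C)" for A
  have bad_UNIV: "bad UNIV"
    using unb by (auto simp: bad_def)
  have step: "\<exists>A'. bad A' \<and> A' \<subseteq> A \<and> 1 \<le> \<bar>s (A - A')\<bar>" if A: "bad A" for A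
  proof -
    \<comment> \<open>The margin \<open>\<bar>s A\<bar> + 1\<close> makes both pieces large, since
      \<open>s (A - B) = s A - s B\<close>.\<close>
    have "\<not> (\<forall>B\<in>sets borel. B \<subseteq> A \<longrightarrow> \<bar>s B\<bar> \<le> \<bar>s A\<bar> + 1)"
      using A unfolding bad_def by blast
    then obtain B where B: "B \<in> sets borel" "B \<subseteq> A" "\<bar>s B\<bar> > \<bar>s A\<bar> + 1"
      by (auto simp: not_le)
    have sd: "s (A - B) = s A - s B"
      using A B by (intro signed_measures_Diff[OF s]) (auto simp: bad_def)
    have "bad B \<or> bad (A - B)"
    proof (rule ccontr)
      assume "\<not> ?thesis"
      then have nb: "\<not> bad B" "\<not> bad (A - B)" by auto
      have AB: "A - B \<in> sets borel"
        using A B(1) by (auto simp: bad_def)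
      obtain C where C1: "\<forall>D\<in>sets borel. D \<subseteq> B \<longrightarrow> \<bar>s D\<bar> \<le> C"
        using nb(1) B(1) unfolding bad_def by blast
      obtain C' where C2: "\<forall>D\<in>sets borel. D \<subseteq> A - B \<longrightarrow> \<bar>s D\<bar> \<le> C'"
        using nb(2) AB unfolding bad_def by blast
      have "\<bar>s D\<bar> \<le> C + C'" if D: "D \<in> sets borel" "D \<subseteq> A" for D
      proof -
        have "s (D \<inter> B \<union> (D - B)) = s (D \<inter> B) + s (D - B)"
          using D B by (intro signed_measures_Un[OF s]) auto
        then have "s D = s (D \<inter> B) + s (D - B)"
          by (simp add: Int_Diff_Un)
        moreover have "\<bar>s (D \<inter> B)\<bar> \<le> C"
          using D B by (intro C1[rule_format]) auto
        moreover have "\<bar>s (D - B)\<bar> \<le> C'"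
          using D B by (intro C2[rule_format]) auto
        ultimately show ?thesis by linarith
      qed
      then show False using A unfolding bad_def by blast
    qed
    moreover have "A - (A - B) = B" using B by auto
    moreover have "1 \<le> \<bar>s (A - B)\<bar>" "1 \<le> \<bar>s B\<bar>" using sd B by linarith+
    ultimately show ?thesis using B by (metis Diff_subset)
  qed
  have "\<exists>f. \<forall>n::nat. bad (f n) \<and> (f (Suc n) \<subseteq> f n \<and> 1 \<le> \<bar>s (f n - f (Suc n))\<bar>)"
    by (rule dependent_nat_choice) (use bad_UNIV step in blast)+
  then obtain f where f: "\<And>n. bad (f n)" "\<And>n. f (Suc n) \<subseteq> f n"
    "\<And>n. 1 \<le> \<bar>s (f n - f (Suc n))\<bar>"
    by blast
  have "decseq f" using f(2) by (simp add: decseq_Suc_iff)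
  then have disj: "disjoint_family (\<lambda>n. f n - f (Suc n))"
    unfolding disjoint_family_on_def
  proof (intro ballI impI)
    fix i j :: nat assume "i \<noteq> j"
    then consider "Suc i \<le> j" | "Suc j \<le> i" by linarith
    then show "(f i - f (Suc i)) \<inter> (f j - f (Suc j)) = {}"
      by cases (use decseqD[OF \<open>decseq f\<close>, of "Suc i" j] decseqD[OF \<open>decseq f\<close>, of "Suc j" i] in auto)
  qed
  have "range (\<lambda>n. f n - f (Suc n)) \<subseteq> sets borel"
    using f(1) by (auto simp: bad_def)
  from signed_measures_sums[OF s this disj]
  have "(\<lambda>n. s (f n - f (Suc n))) \<longlonglongrightarrow> 0"
    using sums_summable summable_LIMSEQ_zero by blast
  then have "(\<lambda>n. \<bar>s (f n - f (Suc n))\<bar>) \<longlonglongrightarrow> 0"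
    by (rule tendsto_rabs_zero)
  then have "1 \<le> (0::real)"
    by (rule LIMSEQ_le_const) (use f(3) in auto)
  then show False by simp
qed

text \<open>Countable additivity of the supremum is two inequalities: joining subsets of disjoint
  sets gives superadditivity, so all partial sums stay below; slicing a single \<open>B\<close>
  along the \<open>F i\<close> gives the converse. Finiteness is the uniform bound on the values of
  \<open>s\<close>.\<close>

lemma pos_part_properties:
  assumes s: "s \<in> signed_measures"
  shows "sets (pos_part s) = sets borel"
    and "A \<in> sets borel \<Longrightarrow>
      emeasure (pos_part s) A = (SUP B\<in>{B \<in> sets borel. B \<subseteq> A}. ennreal (s B))"
    and "finite_measure (pos_part s)"
proof -
  let ?P = "\<lambda>A. SUP B\<in>{B \<in> sets borel. B \<subseteq> A}. ennreal (s B)"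
  show sets: "sets (pos_part s) = sets borel"
    unfolding pos_part_def using sets.sets_measure_of_eq[of borel] by (simp del: sets.sets_measure_of_eq)
  have superadd: "?P A + ?P A' \<le> ?P (A \<union> A')"
    if A: "A \<inter> A' = {}" for A A'
  proof -
    have le: "ennreal (s B) + ennreal (s B') \<le> ?P (A \<union> A')"
      if B: "B \<in> sets borel" "B \<subseteq> A" "B' \<in> sets borel" "B' \<subseteq> A'" for B B'
    proof -
      \<comment> \<open>A negative value is truncated to 0 by \<open>ennreal\<close>, and then the
        other set alone is an admissible competitor.\<close>
      consider "s B \<ge> 0" "s B' \<ge> 0" | "s B \<le> 0" | "s B' \<le> 0" by linarith
      then show ?thesis
      proof cases
        case 1
        have "ennreal (s B) + ennreal (s B') = ennreal (s (B \<union> B'))"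
        proof -
          have "B \<inter> B' = {}" using B A by blast
          then show ?thesis
            using signed_measures_Un[OF s, of B B'] B 1 by (simp add: ennreal_plus)
        qed
        also have "\<dots> \<le> ?P (A \<union> A')"
          using B by (intro SUP_upper) auto
        finally show ?thesis .
      next
        case 2
        have "ennreal (s B') \<le> ?P (A \<union> A')" using B by (intro SUP_upper) auto
        then show ?thesis using 2 by (simp add: ennreal_neg)
      next
        case 3
        have "ennreal (s B) \<le> ?P (A \<union> A')" using B by (intro SUP_upper) auto
        then show ?thesis using 3 by (simp add: ennreal_neg)
      qed
    qed
    have ne: "{B \<in> sets borel. B \<subseteq> A} \<noteq> {}" "{B \<in> sets borel. B \<subseteq> A'} \<noteq> {}"
      by blast+
    have "ennreal (s B) + ?P A' \<le> ?P (A \<union> A')" if "B \<in> {B \<in> sets borel. B \<subseteq> A}" for B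
      unfolding ennreal_SUP_add_right[OF ne(2)] by (rule SUP_least) (use that in \<open>auto intro: le\<close>)
    then show ?thesis
      unfolding ennreal_SUP_add_left[OF ne(1), symmetric] by (rule SUP_least)
  qed
  have add: "(\<Sum>i. ?P (F i)) = ?P (\<Union>i. F i)"
    if F: "range F \<subseteq> sets borel" "disjoint_family F" for F :: "nat \<Rightarrow> 'a set"
  proof (rule antisym)
    have "(\<Sum>i<n. ?P (F i)) \<le> ?P (\<Union>i<n. F i)" for n
    proof (induction n)
      case (Suc n)
      have "(\<Union>i<n. F i) \<inter> F n = {}"
        using F(2) unfolding disjoint_family_on_def by (auto; metis disjoint_iff less_irrefl UNIV_I)
      then have "?P (\<Union>i<n. F i) + ?P (F n) \<le> ?P ((\<Union>i<n. F i) \<union> F n)"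
        by (rule superadd)
      also have "(\<Union>i<n. F i) \<union> F n = (\<Union>i<Suc n. F i)"
        by (auto simp: lessThan_Suc)
      finally show ?case
        using Suc by (simp add: order_trans[OF add_right_mono])
    qed simp
    moreover have "?P (\<Union>i<n. F i) \<le> ?P (\<Union>i. F i)" for n
      by (rule SUP_subset_mono) auto
    ultimately have "(\<Sum>i<n. ?P (F i)) \<le> ?P (\<Union>i. F i)" for n
      using order_trans by blast
    then show "(\<Sum>i. ?P (F i)) \<le> ?P (\<Union>i. F i)"
      by (intro suminf_le_const) auto
  next
    show "?P (\<Union>i. F i) \<le> (\<Sum>i. ?P (F i))"
    proof (rule SUP_least)
      fix B assume "B \<in> {B \<in> sets borel. B \<subseteq> (\<Union>i. F i)}"
      then have B: "B \<in> sets borel" "B = (\<Union>i. B \<inter> F i)" by auto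
      have "(\<lambda>i. s (B \<inter> F i)) sums s (\<Union>i. B \<inter> F i)"
        using F B by (intro signed_measures_sums[OF s]) (auto simp: disjoint_family_on_def)
      then have "(\<lambda>n. \<Sum>i<n. s (B \<inter> F i)) \<longlonglongrightarrow> s B"
        using B(2) by (simp add: sums_def)
      then have lim: "(\<lambda>n. ennreal (\<Sum>i<n. s (B \<inter> F i))) \<longlonglongrightarrow> ennreal (s B)"
        by (rule tendsto_ennrealI)
      have "ennreal (\<Sum>i<n. s (B \<inter> F i)) \<le> (\<Sum>i. ?P (F i))" for n
      proof -
        \<comment> \<open>Negative terms are raised to 0 before the sum is taken apart, because
          \<open>ennreal\<close> is additive on nonnegative terms.\<close>
        have "ennreal (\<Sum>i<n. s (B \<inter> F i)) \<le> ennreal (\<Sum>i<n. max 0 (s (B \<inter> F i)))"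
          by (intro ennreal_leI sum_mono) auto
        also have "\<dots> = (\<Sum>i<n. ennreal (max 0 (s (B \<inter> F i))))"
          by (rule sum_ennreal[symmetric]) auto
        also have "\<dots> = (\<Sum>i<n. ennreal (s (B \<inter> F i)))"
          by (intro sum.cong) (auto simp: max_def ennreal_neg)
        also have "\<dots> \<le> (\<Sum>i<n. ?P (F i))"
          using B F by (intro sum_mono SUP_upper) auto
        also have "\<dots> \<le> (\<Sum>i. ?P (F i))"
          by (rule sum_le_suminf) auto
        finally show ?thesis .
      qed
      then show "ennreal (s B) \<le> (\<Sum>i. ?P (F i))"
        by (intro LIMSEQ_le_const2[OF lim]) auto
    qed
  qed
  have empty: "?P {} = 0"
  proof -
    have "{B \<in> sets borel. B \<subseteq> {}} = {{}}" by auto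
    then show ?thesis using signed_measures_empty[OF s] by simp
  qed
  have em: "emeasure (pos_part s) A = ?P A" if A: "A \<in> sets borel" for A
  proof (rule emeasure_measure_of[OF pos_part_def])
    show "A \<in> sets (pos_part s)" using A sets by simp
    show "positive (sets (pos_part s)) ?P"
      using empty by (simp add: positive_def)
    show "countably_additive (sets (pos_part s)) ?P"
      unfolding countably_additive_def sets using add by blast
  qed auto
  then show "A \<in> sets borel \<Longrightarrow> emeasure (pos_part s) A = ?P A" .
  obtain C where C: "\<And>B. B \<in> sets borel \<Longrightarrow> \<bar>s B\<bar> \<le> C"
    using signed_measures_bounded[OF s] by blast
  have "?P UNIV \<le> ennreal C"
  proof (rule SUP_least)
    fix B :: "'a set" assume "B \<in> {B \<in> sets borel. B \<subseteq> UNIV}"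
    then show "ennreal (s B) \<le> ennreal C"
      by (intro ennreal_leI abs_le_D1[OF C]) simp
  qed
  moreover have "emeasure (pos_part s) UNIV = ?P UNIV"
    by (rule em) simp
  ultimately have "emeasure (pos_part s) UNIV \<le> ennreal C"
    by simp
  moreover have "space (pos_part s) = UNIV"
    using sets_eq_imp_space_eq[OF sets] by simp
  ultimately show "finite_measure (pos_part s)"
    by (intro finite_measureI) (auto simp: top_unique)
qed

lemma neg_part_properties:
  assumes s: "s \<in> signed_measures"
  shows "sets (neg_part s) = sets borel" "finite_measure (neg_part s)"
  using pos_part_properties[OF signed_measures_uminus[OF s]] by (simp_all add: neg_part_def)

text \<open>Replacing \<open>B\<close> by \<open>A - B\<close> turns the value \<open>s B\<close>
  into \<open>s A - s (A - B)\<close>, so the supremum of \<open>s\<close> over subsets of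
  \<open>A\<close> exceeds the supremum of \<open>- s\<close> by exactly \<open>s A\<close>. No Hahn
  set is involved.\<close>

lemma Jordan_decomposition:
  assumes s: "s \<in> signed_measures" and A: "A \<in> sets borel"
  shows "s A = measure (pos_part s) A - measure (neg_part s) A"
proof -
  interpret P: finite_measure "pos_part s" by (rule pos_part_properties[OF s])
  interpret N: finite_measure "neg_part s" by (rule neg_part_properties[OF s])
  note s' = signed_measures_uminus[OF s]
  have P_ub: "s B \<le> measure (pos_part s) A" if "B \<in> sets borel" "B \<subseteq> A" for B
  proof -
    have "ennreal (s B) \<le> emeasure (pos_part s) A"
      unfolding pos_part_properties(2)[OF s A] using that by (intro SUP_upper) auto
    then show ?thesis by (simp add: P.emeasure_eq_measure)
  qed
  have N_ub: "- s B \<le> measure (neg_part s) A" if "B \<in> sets borel" "B \<subseteq> A" for B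
  proof -
    have "ennreal (- s B) \<le> emeasure (neg_part s) A"
      unfolding neg_part_def pos_part_properties(2)[OF s' A] using that by (intro SUP_upper) auto
    then show ?thesis by (simp add: N.emeasure_eq_measure)
  qed
  have P_le: "measure (pos_part s) A \<le> c" if c: "\<And>B. B \<in> sets borel \<Longrightarrow> B \<subseteq> A \<Longrightarrow> s B \<le> c" for c
  proof -
    have "emeasure (pos_part s) A \<le> ennreal c"
      unfolding pos_part_properties(2)[OF s A] by (intro SUP_least ennreal_leI) (use c in auto)
    moreover have "0 \<le> c" using c[of "{}"] signed_measures_empty[OF s] by simp
    ultimately show ?thesis by (simp add: P.emeasure_eq_measure)
  qed
  have N_le: "measure (neg_part s) A \<le> c" if c: "\<And>B. B \<in> sets borel \<Longrightarrow> B \<subseteq> A \<Longrightarrow> - s B \<le> c" for c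
  proof -
    have "emeasure (neg_part s) A \<le> ennreal c"
      unfolding neg_part_def pos_part_properties(2)[OF s' A]
      by (intro SUP_least ennreal_leI) (use c in auto)
    moreover have "0 \<le> c" using c[of "{}"] signed_measures_empty[OF s] by simp
    ultimately show ?thesis by (simp add: N.emeasure_eq_measure)
  qed
  have "measure (pos_part s) A \<le> s A + measure (neg_part s) A"
  proof (rule P_le)
    fix B assume B: "B \<in> sets borel" "B \<subseteq> A"
    then show "s B \<le> s A + measure (neg_part s) A"
      using N_ub[of "A - B"] signed_measures_Diff[OF s A, of B] A by auto
  qed
  moreover have "measure (neg_part s) A \<le> measure (pos_part s) A - s A"
  proof (rule N_le)
    fix B assume B: "B \<in> sets borel" "B \<subseteq> A"
    then show "- s B \<le> measure (pos_part s) A - s A"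
      using P_ub[of "A - B"] signed_measures_Diff[OF s A, of B] A by auto
  qed
  ultimately show ?thesis by linarith
qed

section \<open>Separation of signed measures by continuous functions\<close>

lemma finite_measure_integrable_bcontfun:
  assumes "finite_measure M" "sets M = sets borel"
  shows "integrable M (apply_bcontfun (f :: 'a::metric_space \<Rightarrow>\<^sub>C real))"
proof -
  interpret finite_measure M by fact
  have "apply_bcontfun f \<in> borel_measurable M"
    unfolding measurable_cong_sets[OF assms(2) refl]
    by (intro borel_measurable_continuous_onI continuous_on_apply_bcontfun)
  then show ?thesis
    by (intro integrable_const_bound[where B = "norm f"]) (auto intro: norm_bounded[of f, simplified])
qed

text \<open>Bumps equal to 1 on \<open>C\<close> which, for closed nonempty \<open>C\<close>,
  decrease to its indicator. Since \<open>infdist\<close> to the empty set is 0, the empty set is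
  always treated apart.\<close>

definition closed_bump :: "'a::metric_space set \<Rightarrow> nat \<Rightarrow> 'a \<Rightarrow>\<^sub>C real" where
  "closed_bump C n = Bcontfun (\<lambda>x. max 0 (1 - real n * infdist x C))"

lemma closed_bump_apply: "closed_bump C n x = max 0 (1 - real n * infdist x C)"
proof -
  have "(\<lambda>x. max 0 (1 - real n * infdist x C)) \<in> bcontfun"
  proof (rule bcontfun_normI)
    show "norm (max 0 (1 - real n * infdist x C)) \<le> 1" for x
      using infdist_nonneg[of x C] by auto
  qed (intro continuous_intros)
  then show ?thesis by (simp add: closed_bump_def Bcontfun_inverse)
qed

lemma closed_bump_integral_tendsto:
  fixes C :: "'a::metric_space set"
  assumes L: "finite_measure L" "sets L = sets borel" and C: "closed C" "C \<noteq> {}"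
  shows "(\<lambda>n. \<integral>x. closed_bump C n x \<partial>L) \<longlonglongrightarrow> measure L C"
proof -
  interpret finite_measure L by fact
  have "(\<lambda>n. \<integral>x. closed_bump C n x \<partial>L) \<longlonglongrightarrow> (\<integral>x. indicator C x \<partial>L)"
  proof (rule integral_dominated_convergence[where w = "\<lambda>_. 1"])
    show "apply_bcontfun (closed_bump C n) \<in> borel_measurable L" for n
      using finite_measure_integrable_bcontfun[OF L] by (rule borel_measurable_integrable)
    show "AE x in L. (\<lambda>n. closed_bump C n x) \<longlonglongrightarrow> indicator C x"
    proof (rule AE_I2)
      fix x
      show "(\<lambda>n. closed_bump C n x) \<longlonglongrightarrow> indicator C x"
      proof (cases "x \<in> C")
        case True
        then show ?thesis by (simp add: closed_bump_apply)
      next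
        case False
        then have d: "0 < infdist x C"
          using C infdist_nonneg[of x C] in_closed_iff_infdist_zero[of C x] by linarith
        obtain n0 :: nat where n0: "1 < real n0 * infdist x C"
          using reals_Archimedean3[OF d] by blast
        have "closed_bump C n x = 0" if "n \<ge> n0" for n
        proof -
          have "real n0 * infdist x C \<le> real n * infdist x C"
            using that d by (intro mult_right_mono) auto
          then show ?thesis using n0 by (simp add: closed_bump_apply)
        qed
        then have "\<forall>\<^sub>F n in sequentially. closed_bump C n x = 0"
          by (auto simp: eventually_sequentially)
        then show ?thesis using False by (simp add: tendsto_eventually)
      qed
    qed
    show "(indicator C :: 'a \<Rightarrow> real) \<in> borel_measurable L"
      using C L(2) by (intro borel_measurable_indicator) (auto simp: borel_closed)
    show "AE x in L. norm (closed_bump C n x) \<le> 1" for n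
      using infdist_nonneg[of _ C] by (auto simp: closed_bump_apply)
  qed (auto simp: integrable_const)
  moreover have "(\<integral>x. indicator C x \<partial>L) = measure L C"
    using sets_eq_imp_space_eq[OF L(2)] by simp
  ultimately show ?thesis by simp
qed

text \<open>By the Jordan decomposition the integrals of the bumps converge to the value at a closed
  set. Closed sets are stable under intersection and generate the Borel sets, so the agreement
  spreads by a Dynkin argument; on all other sets both functions are 0 by normalization.\<close>

lemma signed_measures_eqI:
  fixes s t :: "'a::metric_space set \<Rightarrow> real"
  assumes s: "s \<in> signed_measures" and t: "t \<in> signed_measures"
    and eq: "\<And>f :: 'a \<Rightarrow>\<^sub>C real. signed_integral s f = signed_integral t f"
  shows "s = t"
proof
  have lim: "(\<lambda>n. signed_integral r (closed_bump C n)) \<longlonglongrightarrow> r C"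
    if r: "r \<in> signed_measures" and C: "closed C" "C \<noteq> {}" for r and C :: "'a set"
    unfolding signed_integral_def Jordan_decomposition[OF r borel_closed[OF C(1)]]
    by (intro tendsto_diff closed_bump_integral_tendsto C
        pos_part_properties[OF r] neg_part_properties[OF r])
  have closed: "s C = t C" if "closed C" for C
    using lim[OF s that] lim[OF t that] signed_measures_empty[OF s] signed_measures_empty[OF t]
      LIMSEQ_unique by (cases "C = {}") (auto simp: eq)
  fix A
  show "s A = t A"
  proof (cases "A \<in> sets borel")
    case True
    then have "A \<in> sigma_sets UNIV (Collect closed)"
      by (simp add: borel_eq_closed)
    then show ?thesis
    proof (induction rule: sigma_sets_induct_disjoint[rotated 2, consumes 1, case_names basic empty compl union])
      case (basic A)
      then show ?case using closed by simp
    next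
      case (compl A)
      have "A \<in> sets borel" "UNIV \<in> sets borel" using compl(1) by (simp_all add: borel_eq_closed)
      then show ?case
        using compl(2) closed[of UNIV]
        by (simp add: signed_measures_Diff[OF s] signed_measures_Diff[OF t])
    next
      case (union A)
      have "range A \<subseteq> sets borel" using union(2) by (simp add: borel_eq_closed)
      then show ?case
        using signed_measures_sums[OF s _ union(1)] signed_measures_sums[OF t _ union(1)] union(3)
          sums_unique2 by auto
    qed (auto simp: Int_stable_def signed_measures_empty s t)
  next
    case False
    then show ?thesis by (simp add: signed_measures_notin s t)
  qed
qed

lemma Hausdorff_weak_star_topology: "Hausdorff_space weak_star_topology"
  unfolding Hausdorff_space_def topspace_weak_star_topology
proof (intro allI impI)
  fix s t :: "'a set \<Rightarrow> real"
  assume st: "s \<in> signed_measures \<and> t \<in> signed_measures \<and> s \<noteq> t"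
  then obtain f :: "'a \<Rightarrow>\<^sub>C real" where "signed_integral s f \<noteq> signed_integral t f"
    using signed_measures_eqI by blast
  from hausdorff[OF this] obtain U V :: "real set" where
    UV: "open U" "open V" "signed_integral s f \<in> U" "signed_integral t f \<in> V" "U \<inter> V = {}"
    by blast
  have "openin weak_star_topology {r \<in> signed_measures. signed_integral r f \<in> W}" if "open W" for W
    unfolding weak_star_topology_def
    by (intro topology_generated_by_Basis CollectI exI[of _ f] exI[of _ W] conjI refl that)
  then have "openin weak_star_topology {r \<in> signed_measures. signed_integral r f \<in> U}"
    "openin weak_star_topology {r \<in> signed_measures. signed_integral r f \<in> V}"
    using UV(1,2) by blast+
  moreover have "disjnt {r \<in> signed_measures. signed_integral r f \<in> U}
      {r \<in> signed_measures. signed_integral r f \<in> V}"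
    using UV(5) unfolding disjnt_def by blast
  moreover have "s \<in> {r \<in> signed_measures. signed_integral r f \<in> U}"
    "t \<in> {r \<in> signed_measures. signed_integral r f \<in> V}"
    using UV(3,4) st by blast+
  ultimately show "\<exists>U V. openin weak_star_topology U \<and> openin weak_star_topology V \<and>
      s \<in> U \<and> t \<in> V \<and> disjnt U V"
    by blast
qed

section \<open>Borel measurability for the weak* topology\<close>

lemma continuous_map_signed_integral:
  "continuous_map weak_star_topology euclidean (\<lambda>s. signed_integral s (apply_bcontfun f))"
proof (rule continuous_map[THEN iffD2], intro conjI allI impI)
  fix U :: "real set" assume "openin euclidean U"
  then have "openin weak_star_topology {s \<in> signed_measures. signed_integral s f \<in> U}"
    unfolding weak_star_topology_def
    by (intro topology_generated_by_Basis CollectI exI[of _ f] exI[of _ U]) simp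
  then show "openin weak_star_topology {s \<in> topspace weak_star_topology. signed_integral s f \<in> U}"
    by simp
qed simp

lemma sets_weak_star_borel: "sets weak_star_borel = sigma_sets signed_measures {U. openin weak_star_topology U}"
  unfolding weak_star_borel_def
  by (rule sets_measure_of) (use openin_subset in fastforce)

lemma closedin_weak_star_borel:
  assumes "closedin weak_star_topology S"
  shows "S \<in> sets weak_star_borel"
proof -
  have "signed_measures - S \<in> sets weak_star_borel"
    using assms unfolding sets_weak_star_borel closedin_def by auto
  then have "space weak_star_borel - (signed_measures - S) \<in> sets weak_star_borel"
    by blast
  moreover have "space weak_star_borel - (signed_measures - S) = S"
    using closedin_subset[OF assms] by auto
  ultimately show ?thesis by simp
qed

lemma measurable_signed_integral:
  "(\<lambda>s. signed_integral s (apply_bcontfun f)) \<in> borel_measurable weak_star_borel"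
proof (rule borel_measurableI)
  fix U :: "real set" assume "open U"
  then have "openin weak_star_topology {s \<in> topspace weak_star_topology. signed_integral s f \<in> U}"
    using continuous_map_signed_integral by (intro openin_continuous_map_preimage) auto
  moreover have "(\<lambda>s. signed_integral s f) -` U \<inter> space weak_star_borel =
      {s \<in> topspace weak_star_topology. signed_integral s f \<in> U}"
    by auto
  ultimately show "(\<lambda>s. signed_integral s f) -` U \<inter> space weak_star_borel \<in> sets weak_star_borel"
    unfolding sets_weak_star_borel by auto
qed

section \<open>Moment-preserving decomposition of finitely supported weights\<close>

text \<open>Gaussian elimination with equations given by their coefficient functions: an equation
  \<open>g\<close> with nonzero coefficient at \<open>k\<close> removes the unknown
  \<open>k\<close>. The equations form a set, so some may coincide after elimination, which only
  lowers their number.\<close>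

lemma homogeneous_system_nontrivial:
  fixes G :: "('i \<Rightarrow> real) set"
  assumes "finite G" "finite S" "card G < card S"
  shows "\<exists>u. (\<exists>i\<in>S. u i \<noteq> 0) \<and> (\<forall>i. i \<notin> S \<longrightarrow> u i = 0) \<and> (\<forall>g\<in>G. (\<Sum>i\<in>S. u i * g i) = 0)"
  using assms
proof (induction "card G" arbitrary: G S rule: less_induct)
  case less
  show ?case
  proof (cases "G = {}")
    case True
    with less obtain i where "i \<in> S" by fastforce
    then show ?thesis using True by (intro exI[of _ "\<lambda>j. of_bool (j = i)"]) auto
  next
    case False
    then obtain g where g: "g \<in> G" by blast
    define G' where "G' = G - {g}"
    have G': "G = insert g G'" "finite G'" "card G = Suc (card G')"
      unfolding G'_def using insert_Diff[OF g] less.prems(1) card.remove[OF less.prems(1) g]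
      by simp_all
    show ?thesis
    proof (cases "\<forall>i\<in>S. g i = 0")
      case True
      obtain u where u: "\<exists>i\<in>S. u i \<noteq> 0" "\<forall>i. i \<notin> S \<longrightarrow> u i = 0" "\<forall>h\<in>G'. (\<Sum>i\<in>S. u i * h i) = 0"
        using less.hyps[of G' S] less.prems G' by auto
      moreover have "(\<Sum>i\<in>S. u i * g i) = 0"
        using True by (intro sum.neutral) auto
      ultimately show ?thesis using G'(1) by blast
    next
      case False
      then obtain k where k: "k \<in> S" "g k \<noteq> 0" by blast
      \<comment> \<open>This multiple of \<open>g\<close> cancels the coefficient of
        \<open>h\<close> at \<open>k\<close>.\<close>
      define elim where "elim h = (\<lambda>i. h i - h k / g k * g i)" for h
      have card: "card (elim ` G') \<le> card G'" using G' card_image_le by blast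
      then have "card (elim ` G') < card G" "card (elim ` G') < card (S - {k})"
        using G' less.prems k by auto
      then obtain v where v: "\<exists>i\<in>S - {k}. v i \<noteq> 0" "\<forall>i. i \<notin> S - {k} \<longrightarrow> v i = 0"
        "\<forall>h\<in>elim ` G'. (\<Sum>i\<in>S - {k}. v i * h i) = 0"
        using less.hyps[of "elim ` G'" "S - {k}"] less.prems G' by auto
      \<comment> \<open>The value \<open>- c\<close> is what the equation \<open>g\<close> forces on
        the unknown \<open>k\<close>.\<close>
      define c where "c = (\<Sum>i\<in>S - {k}. v i * g i) / g k"
      define u where "u = v(k := - c)"
      have u_sum: "(\<Sum>i\<in>S. u i * h i) = (\<Sum>i\<in>S - {k}. v i * h i) - c * h k" for h
        using k less.prems by (simp add: sum.remove[of S k] u_def)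
      have "(\<Sum>i\<in>S. u i * g i) = 0"
        using k by (simp add: u_sum c_def)
      moreover have "(\<Sum>i\<in>S. u i * h i) = 0" if "h \<in> G'" for h
      proof -
        have "(\<Sum>i\<in>S - {k}. v i * elim h i) = 0" using v(3) that by (simp add: ball_simps)
        also have "(\<Sum>i\<in>S - {k}. v i * elim h i) =
            (\<Sum>i\<in>S - {k}. v i * h i) - (\<Sum>i\<in>S - {k}. v i * g i) * (h k / g k)"
          by (simp add: elim_def right_diff_distrib sum_subtractf sum_distrib_left sum_distrib_right
              sum_divide_distrib mult_ac)
        finally show ?thesis by (simp add: u_sum c_def)
      qed
      moreover have "\<exists>i\<in>S. u i \<noteq> 0" "\<forall>i. i \<notin> S \<longrightarrow> u i = 0"
        using v k by (auto simp: u_def)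
      ultimately show ?thesis using G'(1) by blast
    qed
  qed
qed

text \<open>The ratio test of the simplex method: \<open>t\<close> is the first time at which a
  decreasing coordinate reaches 0.\<close>

lemma nonneg_boundary_step:
  fixes w u :: "'i \<Rightarrow> real"
  assumes fin: "finite S" and w: "\<forall>i\<in>S. 0 < w i" and u: "\<exists>i\<in>S. u i < 0"
  shows "\<exists>t>0. (\<forall>i\<in>S. 0 \<le> w i + t * u i) \<and> (\<exists>i\<in>S. w i + t * u i = 0)"
proof -
  let ?N = "{i \<in> S. u i < 0}"
  define t where "t = Min ((\<lambda>i. w i / - u i) ` ?N)"
  have N: "finite ((\<lambda>i. w i / - u i) ` ?N)" "(\<lambda>i. w i / - u i) ` ?N \<noteq> {}"
    using fin u by auto
  have "t \<in> (\<lambda>i. w i / - u i) ` ?N" unfolding t_def by (rule Min_in[OF N])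
  then obtain k where k: "k \<in> S" "u k < 0" "t = w k / - u k" by blast
  have "0 < t" unfolding k(3) using k w by (intro divide_pos_pos) auto
  moreover have "0 \<le> w i + t * u i" if i: "i \<in> S" for i
  proof (cases "u i < 0")
    case True
    have "t \<le> w i / - u i" unfolding t_def using i True N by (intro Min_le) auto
    then have "t * - u i \<le> w i" using True by (simp only: pos_le_divide_eq neg_0_less_iff_less)
    then show ?thesis by simp
  next
    case False
    then show ?thesis using \<open>0 < t\<close> w i by (intro add_nonneg_nonneg) auto
  qed
  moreover have "w k + t * u k = 0" using k by simp
  ultimately show ?thesis using k(1) by blast
qed

lemma expectation_bind_bernoulli:
  fixes f :: "'b \<Rightarrow> real"
  assumes "0 \<le> a" "a \<le> 1" "finite (set_pmf p)" "finite (set_pmf q)"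
  shows "measure_pmf.expectation (bind_pmf (bernoulli_pmf a) (\<lambda>b. if b then p else q)) f =
    a * measure_pmf.expectation p f + (1 - a) * measure_pmf.expectation q f"
  using assms
  by (subst pmf_expectation_bind[where A = UNIV]) (auto simp: UNIV_bool)

text \<open>A weight with more than \<open>card G + 1\<close> atoms is interior to a segment whose direction solves
  the homogeneous moment equations and whose two end points have fewer atoms.\<close>

lemma moment_preserving_decomposition:
  fixes G :: "('i \<Rightarrow> real) set" and w :: "'i \<Rightarrow> real"
  assumes G: "finite G" and S: "finite S" and w: "\<And>i. 0 \<le> w i" "\<And>i. i \<notin> S \<Longrightarrow> w i = 0"
  shows "\<exists>p :: ('i \<Rightarrow> real) pmf. finite (set_pmf p) \<and>
     (\<forall>v\<in>set_pmf p. (\<forall>i. 0 \<le> v i) \<and> (\<forall>i. i \<notin> S \<longrightarrow> v i = 0) \<and> sum v S = sum w S \<and>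
        card {i \<in> S. v i \<noteq> 0} \<le> card G + 1 \<and> (\<forall>g\<in>G. (\<Sum>i\<in>S. v i * g i) = (\<Sum>i\<in>S. w i * g i))) \<and>
     (\<forall>i. measure_pmf.expectation p (\<lambda>v. v i) = w i)"
  using w
proof (induction "card {i \<in> S. w i \<noteq> 0}" arbitrary: w rule: less_induct)
  case less
  define A where "A = {i \<in> S. w i \<noteq> 0}"
  have A: "finite A" "A \<subseteq> S" using S by (auto simp: A_def)
  show ?case
  proof (cases "card A \<le> card G + 1")
    case True
    then show ?thesis using less.prems
      by (intro exI[of _ "return_pmf w"]) (auto simp: A_def)
  next
    case False
    \<comment> \<open>The constant function joins the equations so that motion along
      \<open>u\<close> preserves the total mass; at most \<open>card G + 1\<close> equations then
      face at least \<open>card G + 2\<close> atoms.\<close>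
    have "card (insert (\<lambda>_. 1) G) < card A"
      using False G card_insert_le_m1[of "card G + 1" G] by (auto simp: card_insert_if)
    from homogeneous_system_nontrivial[OF _ A(1) this] G
    obtain u where u: "\<exists>i\<in>A. u i \<noteq> 0" "\<And>i. i \<notin> A \<Longrightarrow> u i = 0"
      "\<And>g. g \<in> insert (\<lambda>_. 1) G \<Longrightarrow> (\<Sum>i\<in>A. u i * g i) = 0"
      by (metis finite_insert)
    have u_S: "(\<Sum>i\<in>S. u i * g i) = 0" if "g \<in> insert (\<lambda>_. 1) G" for g
    proof -
      have "(\<Sum>i\<in>S. u i * g i) = (\<Sum>i\<in>A. u i * g i)"
        using A S u(2) by (intro sum.mono_neutral_right) auto
      then show ?thesis using u(3)[OF that] by simp
    qed
    have wpos: "\<forall>i\<in>A. 0 < w i"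
      using less.prems(1) by (simp add: A_def less_le)
    have sum0: "sum u A = 0" using u(3)[of "\<lambda>_. 1"] by simp
    \<comment> \<open>A nonzero direction with sum 0 has entries of both signs, so moving either way
      eventually brings some coordinate to 0.\<close>
    have "\<exists>i\<in>A. u i < 0"
      using u(1) sum0 sum_nonneg_eq_0_iff[OF A(1), of u] by (meson not_le)
    from nonneg_boundary_step[OF A(1) wpos this] obtain s where
      s: "0 < s" "\<forall>i\<in>A. 0 \<le> w i + s * u i" "\<exists>i\<in>A. w i + s * u i = 0" by blast
    have "\<exists>i\<in>A. - u i < 0"
      using u(1) sum0 sum_nonneg_eq_0_iff[OF A(1), of "\<lambda>i. - u i"]
      by (auto simp: sum_negf) (meson not_le)
    from nonneg_boundary_step[OF A(1) wpos this] obtain t where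
      t: "0 < t" "\<forall>i\<in>A. 0 \<le> w i + t * - u i" "\<exists>i\<in>A. w i + t * - u i = 0" by blast
    have sub: "\<exists>p :: ('i \<Rightarrow> real) pmf. finite (set_pmf p) \<and>
     (\<forall>v\<in>set_pmf p. (\<forall>i. 0 \<le> v i) \<and> (\<forall>i. i \<notin> S \<longrightarrow> v i = 0) \<and> sum v S = sum w S \<and>
        card {i \<in> S. v i \<noteq> 0} \<le> card G + 1 \<and> (\<forall>g\<in>G. (\<Sum>i\<in>S. v i * g i) = (\<Sum>i\<in>S. w i * g i))) \<and>
     (\<forall>i. measure_pmf.expectation p (\<lambda>v. v i) = w i + r * u i)"
      if r: "\<forall>i\<in>A. 0 \<le> w i + r * u i" "\<exists>i\<in>A. w i + r * u i = 0" for r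
    proof -
      let ?w = "\<lambda>i. w i + r * u i"
      have nn: "0 \<le> ?w i" for i
        using r(1) less.prems(1)[of i] u(2)[of i] by (cases "i \<in> A") auto
      have out: "?w i = 0" if "i \<notin> S" for i
        using that less.prems(2)[of i] u(2)[of i] A by auto
      have "{i \<in> S. ?w i \<noteq> 0} \<subset> A"
        using r(2) u(2) by (auto simp: A_def)
      then have "card {i \<in> S. ?w i \<noteq> 0} < card {i \<in> S. w i \<noteq> 0}"
        using A(1) unfolding A_def[symmetric] by (intro psubset_card_mono)
      from less.hyps[OF this nn out] obtain p where p: "finite (set_pmf p)"
        "\<forall>v\<in>set_pmf p. (\<forall>i. 0 \<le> v i) \<and> (\<forall>i. i \<notin> S \<longrightarrow> v i = 0) \<and> sum v S = sum ?w S \<and>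
          card {i \<in> S. v i \<noteq> 0} \<le> card G + 1 \<and> (\<forall>g\<in>G. (\<Sum>i\<in>S. v i * g i) = (\<Sum>i\<in>S. ?w i * g i))"
        "\<forall>i. measure_pmf.expectation p (\<lambda>v. v i) = ?w i"
        by blast
      have moment: "(\<Sum>i\<in>S. ?w i * g i) = (\<Sum>i\<in>S. w i * g i)" if "g \<in> insert (\<lambda>_. 1) G" for g
        using u_S[OF that] by (simp add: distrib_right sum.distrib mult.assoc sum_distrib_left[symmetric])
      have "sum ?w S = sum w S" using moment[of "\<lambda>_. 1"] by simp
      with p moment show ?thesis by auto
    qed
    obtain p where p: "finite (set_pmf p)"
      "\<forall>v\<in>set_pmf p. (\<forall>i. 0 \<le> v i) \<and> (\<forall>i. i \<notin> S \<longrightarrow> v i = 0) \<and> sum v S = sum w S \<and>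
        card {i \<in> S. v i \<noteq> 0} \<le> card G + 1 \<and> (\<forall>g\<in>G. (\<Sum>i\<in>S. v i * g i) = (\<Sum>i\<in>S. w i * g i))"
      "\<forall>i. measure_pmf.expectation p (\<lambda>v. v i) = w i + s * u i"
      using sub[OF s(2,3)] by blast
    obtain q where q: "finite (set_pmf q)"
      "\<forall>v\<in>set_pmf q. (\<forall>i. 0 \<le> v i) \<and> (\<forall>i. i \<notin> S \<longrightarrow> v i = 0) \<and> sum v S = sum w S \<and>
        card {i \<in> S. v i \<noteq> 0} \<le> card G + 1 \<and> (\<forall>g\<in>G. (\<Sum>i\<in>S. v i * g i) = (\<Sum>i\<in>S. w i * g i))"
      "\<forall>i. measure_pmf.expectation q (\<lambda>v. v i) = w i + - t * u i"
      using sub[of "- t"] t(2,3) by auto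
    \<comment> \<open>The solution of \<open>a * s = (1 - a) * t\<close>, which puts the mean of the
      two end points at \<open>w\<close>.\<close>
    define a where "a = t / (s + t)"
    have a: "0 \<le> a" "a \<le> 1" using s t by (auto simp: a_def)
    define P where "P = bind_pmf (bernoulli_pmf a) (\<lambda>b. if b then p else q)"
    have set: "set_pmf P \<subseteq> set_pmf p \<union> set_pmf q"
      by (auto simp: P_def split: if_splits)
    have "measure_pmf.expectation P (\<lambda>v. v i) = w i" for i
    proof -
      have "measure_pmf.expectation P (\<lambda>v. v i) = a * (w i + s * u i) + (1 - a) * (w i + - t * u i)"
        unfolding P_def using expectation_bind_bernoulli[OF a p(1) q(1)] p(3) q(3) by simp
      also have "\<dots> = w i + (a * s - (1 - a) * t) * u i"
        by (simp add: algebra_simps)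
      also have "a * s - (1 - a) * t = 0"
        using s t by (simp add: a_def field_simps)
      finally show ?thesis by simp
    qed
    moreover have "finite (set_pmf P)"
      using set p q by (auto intro: finite_subset)
    ultimately show ?thesis
      using p(2) q(2) set by (intro exI[of _ P]) blast
  qed
qed

section \<open>Weak compactness of probability measures on a compact metric space\<close>

lemma compact_Pi_UNIV:
  fixes S :: "'i \<Rightarrow> 'b::topological_space set"
  assumes "\<And>i. compact (S i)"
  shows "compact {f. \<forall>i. f i \<in> S i}"
proof -
  have "compactin (product_topology (\<lambda>_. euclidean) UNIV) (PiE UNIV S)"
    using assms by (simp add: compactin_PiE)
  moreover have "PiE UNIV S = {f. \<forall>i. f i \<in> S i}"
    by (auto simp: PiE_def Pi_def)
  ultimately show ?thesis
    by (simp add: euclidean_product_topology)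
qed

section \<open>Digit series, and compact metric spaces as images of compact sets of reals\<close>

text \<open>Two ratios are used. For \<open>r = 1/2\<close> this is the binary expansion, which
  reaches every number in \<open>[0, 1)\<close>; for \<open>r = 1/3\<close> it is half of a point of
  the Cantor set, and distinct bit sequences stay distinct.\<close>

definition digit_sum :: "real \<Rightarrow> (nat \<Rightarrow> bool) \<Rightarrow> real" where
  "digit_sum r b = (\<Sum>k. of_bool (b k) * r ^ Suc k)"

lemma summable_digit_sum:
  fixes r :: real
  assumes "0 < r" "r < 1"
  shows "summable (\<lambda>k. of_bool (b k) * r ^ Suc k)"
proof (rule summable_comparison_test'[where g = "\<lambda>k. r ^ Suc k" and N = 0])
  show "summable (\<lambda>k. r ^ Suc k)"
    using assms by (simp add: summable_geometric)
  show "norm (of_bool (b k) * r ^ Suc k) \<le> r ^ Suc k" if "k \<ge> 0" for k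
    using assms by auto
qed

lemma continuous_on_digit_sum:
  assumes r: "0 < r" "r < 1"
  shows "continuous_on UNIV (digit_sum r)"
proof (rule uniform_limit_theorem)
  have "uniform_limit UNIV (\<lambda>n b. \<Sum>k<n. of_bool (b k) * r ^ Suc k)
      (\<lambda>b. \<Sum>k. of_bool (b k) * r ^ Suc k) sequentially"
  proof (rule Weierstrass_m_test)
    show "norm (of_bool (b k) * r ^ Suc k) \<le> r ^ Suc k" for k and b :: "nat \<Rightarrow> bool"
      using r by auto
    show "summable (\<lambda>k. r ^ Suc k)"
      using r by (simp add: summable_geometric)
  qed
  then show "uniform_limit UNIV (\<lambda>n b. \<Sum>k<n. of_bool (b k) * r ^ Suc k) (digit_sum r) sequentially"
    by (simp add: digit_sum_def[abs_def])
  have "continuous_on UNIV (of_bool :: bool \<Rightarrow> real)"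
    by (simp add: continuous_on_open_vimage open_discrete)
  then have "continuous_on UNIV (\<lambda>b :: nat \<Rightarrow> bool. of_bool (b k) :: real)" for k
    by (rule continuous_on_compose2) auto
  then show "\<forall>\<^sub>F n in sequentially. continuous_on UNIV
      (\<lambda>b :: nat \<Rightarrow> bool. \<Sum>k<n. of_bool (b k) * r ^ Suc k)"
    by (intro always_eventually allI continuous_intros)
qed auto

text \<open>At the first disagreement the term \<open>r ^ Suc n\<close> outweighs the whole
  geometric tail \<open>r ^ (n + 2) / (1 - r)\<close>; this is where \<open>r < 1/2\<close>
  enters.\<close>

lemma digit_sum_less:
  assumes r: "0 < r" "r < 1/2" and b: "b n" "\<not> b' n" "\<And>k. k < n \<Longrightarrow> b k = b' k"
  shows "digit_sum r b' < digit_sum r b"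
proof -
  have r1: "r < 1" using r by simp
  note summ = summable_digit_sum[OF r(1) r1]
  have split: "digit_sum r c = (\<Sum>k. of_bool (c (k + Suc n)) * r ^ Suc (k + Suc n)) +
      ((\<Sum>k<n. of_bool (c k) * r ^ Suc k) + of_bool (c n) * r ^ Suc n)" for c
    unfolding digit_sum_def by (subst suminf_split_initial_segment[OF summ, of _ "Suc n"]) simp
  have tail: "summable (\<lambda>k. of_bool (c (k + Suc n)) * r ^ Suc (k + Suc n))" for c
    using summable_ignore_initial_segment[OF summ[of c], of "Suc n"] .
  have geo: "(\<lambda>k. r ^ Suc (k + Suc n)) sums (r ^ (n + 2) * (1 / (1 - r)))"
    using sums_mult[OF geometric_sums[of r], of "r ^ (n + 2)"] r r1
    by (simp add: power_add mult_ac)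
  have "(\<Sum>k. of_bool (b' (k + Suc n)) * r ^ Suc (k + Suc n)) \<le> (\<Sum>k. r ^ Suc (k + Suc n))"
    using r by (intro suminf_le tail sums_summable[OF geo]) auto
  also have "\<dots> = r ^ Suc n * (r / (1 - r))"
    using sums_unique[OF geo, symmetric] by (simp add: mult_ac)
  also have "\<dots> < r ^ Suc n * 1"
    using r by (intro mult_strict_left_mono) (auto simp: field_simps)
  finally have "(\<Sum>k. of_bool (b' (k + Suc n)) * r ^ Suc (k + Suc n)) < r ^ Suc n" by simp
  moreover have "0 \<le> (\<Sum>k. of_bool (b (k + Suc n)) * r ^ Suc (k + Suc n))"
    using r by (intro suminf_nonneg tail) auto
  moreover have "(\<Sum>k<n. of_bool (b k) * r ^ Suc k) = (\<Sum>k<n. of_bool (b' k) * r ^ Suc k)"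
    using b(3) by (intro sum.cong) auto
  ultimately show ?thesis
    unfolding split[of b] split[of b'] using b by simp
qed

lemma inj_digit_sum:
  assumes "0 < r" "r < 1/2"
  shows "inj (digit_sum r)"
proof (rule injI, rule ccontr)
  fix b b' assume eq: "digit_sum r b = digit_sum r b'" and ne: "b \<noteq> b'"
  define n where "n = (LEAST k. b k \<noteq> b' k)"
  have n: "b n \<noteq> b' n"
    unfolding n_def using ne by (intro LeastI_ex[of "\<lambda>k. b k \<noteq> b' k"]) (simp add: fun_eq_iff)
  have below: "b k = b' k" if "k < n" for k
    using not_less_Least that unfolding n_def by blast
  show False
  proof (cases "b n")
    case True
    then show False using digit_sum_less[OF assms, of b n b'] n below eq by simp
  next
    case False
    then show False using digit_sum_less[OF assms, of b' n b] n below eq by simp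
  qed
qed

text \<open>The digits are the parities of \<open>\<lfloor>2 ^ Suc k * x\<rfloor>\<close>, and the
  partial sums are then the dyadic truncations of \<open>x\<close>. The bound \<open>x < 1\<close>
  makes the truncation of order 0 vanish, as the empty sum requires.\<close>

lemma digit_sum_half_surj:
  assumes x: "0 \<le> x" "x < 1"
  shows "\<exists>b. digit_sum (1/2) b = x"
proof -
  define b where "b k = odd \<lfloor>2 ^ Suc k * x\<rfloor>" for k
  have fl: "\<lfloor>2 * y\<rfloor> = 2 * \<lfloor>y\<rfloor> + of_bool (odd \<lfloor>2 * y\<rfloor>)" for y :: real
  proof -
    have "\<lfloor>2 * y\<rfloor> = 2 * \<lfloor>y\<rfloor> \<or> \<lfloor>2 * y\<rfloor> = 2 * \<lfloor>y\<rfloor> + 1" by linarith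
    then show ?thesis by auto
  qed
  have partial: "(\<Sum>k<n. of_bool (b k) * (1/2) ^ Suc k) = \<lfloor>2 ^ n * x\<rfloor> / 2 ^ n" for n
  proof (induction n)
    case 0
    have "\<lfloor>x\<rfloor> = 0" using x by linarith
    then show ?case by simp
  next
    case (Suc n)
    have "real_of_int \<lfloor>2 ^ Suc n * x\<rfloor> = 2 * real_of_int \<lfloor>2 ^ n * x\<rfloor> + of_bool (b n)"
      using arg_cong[OF fl[of "2 ^ n * x"], of real_of_int] by (simp add: b_def mult.assoc)
    then show ?case
      using Suc by (simp add: field_simps)
  qed
  have "(\<lambda>n. \<lfloor>2 ^ n * x\<rfloor> / 2 ^ n) \<longlonglongrightarrow> x"
  proof (rule LIM_zero_cancel, rule Lim_null_comparison)
    show "\<forall>\<^sub>F n in sequentially. norm (\<lfloor>2 ^ n * x\<rfloor> / 2 ^ n - x) \<le> (1/2) ^ n"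
    proof (intro always_eventually allI)
      fix n
      have "\<bar>real_of_int \<lfloor>2 ^ n * x\<rfloor> - 2 ^ n * x\<bar> \<le> 1" by linarith
      moreover have "\<lfloor>2 ^ n * x\<rfloor> / 2 ^ n - x = (\<lfloor>2 ^ n * x\<rfloor> - 2 ^ n * x) / 2 ^ n"
        by (simp add: diff_divide_distrib)
      ultimately show "norm (\<lfloor>2 ^ n * x\<rfloor> / 2 ^ n - x) \<le> (1/2) ^ n"
        by (simp add: power_one_over divide_right_mono)
    qed
    show "(\<lambda>n. (1/2) ^ n :: real) \<longlonglongrightarrow> 0"
      by (rule LIMSEQ_power_zero) simp
  qed
  then have "(\<lambda>k. of_bool (b k) * (1/2) ^ Suc k) sums x"
    unfolding sums_def partial .
  then show ?thesis
    unfolding digit_sum_def by (metis sums_unique)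
qed

text \<open>The Hausdorff-Alexandroff theorem with Cantor space realized on the line: distances to a
  dense sequence embed \<open>T\<close> in a cube, binary digits cover the cube, and the bit
  sequences that land in the image of \<open>T\<close> are encoded as a compact set of
  reals.\<close>

lemma compact_imp_continuous_image_real:
  fixes T :: "'a::metric_space set"
  assumes T: "compact T"
  shows "\<exists>(K :: real set) g. compact K \<and> continuous_on K g \<and> g ` K = T"
proof (cases "T = {}")
  case False
  have "\<forall>n. \<exists>F. finite F \<and> F \<subseteq> T \<and> T \<subseteq> (\<Union>x\<in>F. ball x (1 / real (Suc n)))"
  proof
    fix n
    obtain F where "F \<subseteq> T" "finite F" "T \<subseteq> (\<Union>x\<in>F. ball x (1 / real (Suc n)))"
      using T by (rule compactE_image[of T T "\<lambda>x. ball x (1 / real (Suc n))"]) auto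
    then show "\<exists>F. finite F \<and> F \<subseteq> T \<and> T \<subseteq> (\<Union>x\<in>F. ball x (1 / real (Suc n)))"
      by blast
  qed
  then obtain F where F: "\<And>n. finite (F n)" "\<And>n. F n \<subseteq> T"
    "\<And>n. T \<subseteq> (\<Union>x\<in>F n. ball x (1 / real (Suc n)))"
    by metis
  define D where "D = (\<Union>n. F n)"
  have "countable D" using F(1) by (auto simp: D_def countable_finite)
  moreover have "D \<noteq> {}" using F(3)[of 0] False by (auto simp: D_def)
  ultimately obtain q :: "nat \<Rightarrow> 'a" where q: "range q = D"
    by (metis range_from_nat_into)
  \<comment> \<open>The cut at \<open>1/2\<close> keeps coordinates inside \<open>[0, 1)\<close>,
    where binary digits exist. It leaves small distances unchanged, and injectivity uses only those:
    a net point close to \<open>x\<close> has to be equally close to \<open>y\<close>.\<close>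
  define e where "e x = (\<lambda>k. min (1/2) (dist x (q k)))" for x
  have e_cont: "continuous_on T e"
    unfolding e_def by (intro continuous_on_coordinatewise_then_product continuous_intros)
  have e_inj: "inj_on e T"
  proof (rule inj_onI, rule ccontr)
    fix x y assume xy: "x \<in> T" "y \<in> T" "e x = e y" "x \<noteq> y"
    then have "0 < min (1/2) (dist x y / 2)" by simp
    then obtain n where n: "1 / real (Suc n) < min (1/2) (dist x y / 2)"
      using reals_Archimedean unfolding inverse_eq_divide by blast
    obtain d where d: "d \<in> F n" "dist d x < 1 / real (Suc n)"
      using F(3)[of n] xy(1) by auto
    then obtain k where k: "d = q k" using q by (force simp: D_def)
    have "min (1/2) (dist x d) = min (1/2) (dist y d)"
      using fun_cong[OF xy(3), of k] by (simp add: e_def k)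
    then have "dist y d < min (1/2) (dist x y / 2)" "dist x d < min (1/2) (dist x y / 2)"
      using d(2) n by (auto simp: dist_commute min_def split: if_splits)
    then show False using dist_triangle2[of x y d] by simp
  qed
  have e_inv: "continuous_on (e ` T) (inv_into T e)"
    using e_cont T e_inj by (intro continuous_on_inv) auto
  \<comment> \<open>\<open>prod_encode\<close> splits one bit sequence into countably many, one for
    each coordinate of the cube.\<close>
  define h where "h b = (\<lambda>i. digit_sum (1/2) (\<lambda>j. b (prod_encode (i, j))))" for b
  have h_cont: "continuous_on UNIV h"
    unfolding h_def
    by (intro continuous_on_coordinatewise_then_product
        continuous_on_compose2[OF continuous_on_digit_sum]) auto
  have h_surj: "\<exists>b. h b = e x" for x
  proof -
    have "\<exists>b. digit_sum (1/2) b = e x i" for i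
      by (rule digit_sum_half_surj) (auto simp: e_def)
    then obtain B where B: "\<And>i. digit_sum (1/2) (B i) = e x i" by metis
    show ?thesis
      by (rule exI[of _ "\<lambda>n. case prod_decode n of (i, j) \<Rightarrow> B i j"]) (auto simp: h_def B)
  qed
  \<comment> \<open>A ratio below \<open>1/2\<close>, as injectivity demands; compactness of the
    space of bit sequences then makes the inverse continuous.\<close>
  define c where "c = digit_sum (1/3)"
  have c: "continuous_on UNIV c" "inj c"
    unfolding c_def by (intro continuous_on_digit_sum inj_digit_sum; simp)+
  have comp: "compact (UNIV :: (nat \<Rightarrow> bool) set)"
    using compact_Pi_UNIV[of "\<lambda>_ :: nat. UNIV :: bool set"] by (simp add: finite_imp_compact)
  have c_inv: "continuous_on (range c) (inv c)"
    using c comp by (intro continuous_on_inv) auto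
  define C where "C = h -` (e ` T)"
  have "closed (e ` T)"
    using e_cont T by (intro compact_imp_closed compact_continuous_image)
  then have "closed C"
    unfolding C_def using h_cont continuous_on_closed_vimage[of UNIV h] by auto
  then have "compact C"
    using compact_Int_closed[OF comp] by simp
  then have "compact (c ` C)"
    using c by (intro compact_continuous_image) (auto intro: continuous_on_subset)
  moreover have "continuous_on (c ` C) (\<lambda>u. inv_into T e (h (inv c u)))"
    by (intro continuous_on_compose2[OF e_inv] continuous_on_compose2[OF h_cont]
        continuous_on_subset[OF c_inv]) (auto simp: C_def c inv_f_f)
  moreover have "(\<lambda>u. inv_into T e (h (inv c u))) ` c ` C = T"
  proof -
    have "(\<lambda>u. inv_into T e (h (inv c u))) ` c ` C = inv_into T e ` (h ` C)"
      by (simp add: image_image inv_f_f[OF c(2)])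
    also have "h ` C = e ` T"
    proof
      show "h ` C \<subseteq> e ` T" by (auto simp: C_def)
      show "e ` T \<subseteq> h ` C"
      proof
        fix z assume z: "z \<in> e ` T"
        then obtain b where "h b = z" using h_surj by blast
        with z have "b \<in> C" "z = h b" by (simp_all add: C_def)
        then show "z \<in> h ` C" by blast
      qed
    qed
    also have "inv_into T e ` (e ` T) = T"
      using e_inj by (simp add: inv_into_image_cancel)
    finally show ?thesis .
  qed
  ultimately show ?thesis by blast
qed auto

text \<open>The laws are moved to the line by a section of \<open>g\<close>, Helly's theorem is
  applied there, and the limit is pushed forward by \<open>g\<close>. The section may be chosen
  arbitrarily, because every function is measurable for a \<open>pmf\<close> and the test functions
  see only its composition with \<open>g\<close>, which is the identity on \<open>T\<close>.\<close>

lemma compact_pmf_weakly_convergent_subsequence: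
  fixes p :: "nat \<Rightarrow> 'b::metric_space pmf"
  assumes T: "compact T" and p: "\<And>n. set_pmf (p n) \<subseteq> T"
  shows "\<exists>r M. strict_mono (r :: nat \<Rightarrow> nat) \<and> prob_space M \<and> sets M = sets borel \<and>
    (AE x in M. x \<in> T) \<and>
    (\<forall>F :: 'b \<Rightarrow> real. continuous_on UNIV F \<longrightarrow>
       (\<lambda>n. measure_pmf.expectation (p (r n)) F) \<longlonglongrightarrow> (\<integral>x. F x \<partial>M))"
proof -
  obtain K :: "real set" and g where K: "compact K" "continuous_on K g" "g ` K = T"
    using compact_imp_continuous_image_real[OF T] by blast
  obtain t0 where t0: "t0 \<in> T"
    using p[of 0] set_pmf_not_empty[of "p 0"] by blast
  have K_ne: "K \<noteq> {}" using K(3) t0 by auto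
  define \<sigma> where "\<sigma> = inv_into K g"
  have \<sigma>: "\<sigma> x \<in> K" "g (\<sigma> x) = x" if "x \<in> T" for x
    using that K(3) by (auto simp: \<sigma>_def inv_into_into f_inv_into_f)
  define m where "m n = distr (measure_pmf (p n)) borel \<sigma>" for n
  have m_dist: "real_distribution (m n)" for n
    unfolding m_def real_distribution_def real_distribution_axioms_def
    by (auto intro!: measure_pmf.prob_space_distr)
  have m_int: "(\<integral>u. \<phi> u \<partial>m n) = measure_pmf.expectation (p n) (\<lambda>x. \<phi> (\<sigma> x))"
    if "\<phi> \<in> borel_measurable borel" for n and \<phi> :: "real \<Rightarrow> real"
    unfolding m_def using that by (intro integral_distr) auto
  obtain B where B: "\<And>u. u \<in> K \<Longrightarrow> \<bar>u\<bar> \<le> B"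
    using compact_imp_bounded[OF K(1)] by (auto simp: bounded_iff)
  have B0: "0 \<le> B" using B K_ne by force
  have "tight m"
    unfolding tight_def
  proof (intro conjI allI impI m_dist)
    fix \<epsilon> :: real assume "0 < \<epsilon>"
    \<comment> \<open>The interval is open on the left, hence the extra 1.\<close>
    have "measure (m n) {- B - 1<..B} = 1" for n
    proof -
      have "AE x in measure_pmf (p n). \<sigma> x \<in> {- B - 1<..B}"
        using B \<sigma>(1) p[of n] by (fastforce simp: AE_measure_pmf_iff abs_le_iff)
      then show ?thesis
        unfolding m_def by (simp add: measure_distr measure_pmf.prob_eq_1 vimage_def)
    qed
    then show "\<exists>a b. a < b \<and> (\<forall>n. 1 - \<epsilon> < measure (m n) {a<..b})"
      using \<open>0 < \<epsilon>\<close> B0 by (intro exI[of _ "- B - 1"] exI[of _ B]) auto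
  qed
  from tight_imp_convergent_subsubsequence[OF this strict_mono_id]
  obtain r M' where r: "strict_mono r" "real_distribution M'" "weak_conv_m (m \<circ> r) M'"
    by auto
  interpret M': real_distribution M' by fact
  have conv: "(\<lambda>n. measure_pmf.expectation (p (r n)) (\<lambda>x. \<phi> (\<sigma> x))) \<longlonglongrightarrow> (\<integral>u. \<phi> u \<partial>M')"
    if \<phi>: "continuous_on UNIV \<phi>" "\<And>u. \<bar>\<phi> u\<bar> \<le> b" for \<phi> :: "real \<Rightarrow> real" and b
  proof -
    have "(\<lambda>n. integral\<^sup>L ((m \<circ> r) n) \<phi>) \<longlonglongrightarrow> integral\<^sup>L M' \<phi>"
      using \<phi> r m_dist
      by (intro weak_conv_imp_integral_bdd_continuous_conv[where B = b])
         (auto simp: continuous_on_eq_continuous_at o_def)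
    then show ?thesis
      using \<phi>(1) by (simp add: m_int borel_measurable_continuous_onI)
  qed
  have AE_K: "AE u in M'. u \<in> K"
  proof -
    \<comment> \<open>This bounded continuous function is zero exactly on the closed set
      \<open>K\<close>, so its vanishing mean in the limit confines \<open>M'\<close> to
      \<open>K\<close>.\<close>
    define \<phi> where "\<phi> u = min 1 (infdist u K)" for u
    have \<phi>: "continuous_on UNIV \<phi>" "\<And>u. 0 \<le> \<phi> u" "\<And>u. \<bar>\<phi> u\<bar> \<le> 1"
      by (auto simp: \<phi>_def infdist_nonneg intro!: continuous_intros)
    have "measure_pmf.expectation (p n) (\<lambda>x. \<phi> (\<sigma> x)) = 0" for n
      using \<sigma>(1) p[of n]
      by (intro integral_eq_zero_AE) (auto simp: AE_measure_pmf_iff \<phi>_def)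
    then have "(\<integral>u. \<phi> u \<partial>M') = 0"
      using conv[OF \<phi>(1,3)] by (simp add: LIMSEQ_const_iff)
    moreover have "integrable M' \<phi>"
      using \<phi>(3) borel_measurable_continuous_onI[OF \<phi>(1)]
      by (intro M'.integrable_const_bound[where B = 1]) auto
    ultimately have "AE u in M'. \<phi> u = 0"
      using \<phi>(2) by (subst (asm) integral_nonneg_eq_0_iff_AE) auto
    then show ?thesis
      using in_closed_iff_infdist_zero[OF compact_imp_closed[OF K(1)] K_ne]
      by (auto simp: \<phi>_def min_def split: if_splits)
  qed
  \<comment> \<open>The value \<open>t0\<close> off \<open>K\<close> gives a total Borel function
    into \<open>T\<close>; it is taken only on a null set of \<open>M'\<close>.\<close>
  define g' where "g' u = (if u \<in> K then g u else t0)" for u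
  have g'[measurable]: "g' \<in> borel_measurable M'"
  proof -
    have "g' \<in> borel_measurable borel"
      unfolding g'_def using K compact_imp_closed[OF K(1)]
      by (intro borel_measurable_continuous_on_if) auto
    then show ?thesis by simp
  qed
  define M where "M = distr M' borel g'"
  have "prob_space M" "sets M = sets borel"
    by (auto simp: M_def intro!: M'.prob_space_distr g')
  moreover have "AE x in M. x \<in> T"
    unfolding M_def using K(3) t0 compact_imp_closed[OF T] g'
    by (subst AE_distr_iff) (auto simp: g'_def)
  moreover have "(\<lambda>n. measure_pmf.expectation (p (r n)) F) \<longlonglongrightarrow> (\<integral>x. F x \<partial>M)"
    if F: "continuous_on UNIV F" for F :: "'b \<Rightarrow> real"
  proof -
    have Fg: "continuous_on K (\<lambda>u. F (g u))"
      by (rule continuous_on_compose2[OF F K(2)]) auto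
    obtain b where b: "0 \<le> b" "\<And>u. u \<in> K \<Longrightarrow> norm (F (g u)) \<le> b"
      using compact_imp_bounded[OF compact_continuous_image[OF Fg K(1)]]
      unfolding bounded_iff by (metis K_ne ex_in_conv imageI norm_ge_zero order_trans)
    \<comment> \<open>\<open>F\<close> composed with \<open>g\<close> is known to be continuous on
      \<open>K\<close>, while weak convergence tests bounded continuous functions on the whole line;
      Tietze's extension keeps the bound \<open>b\<close>.\<close>
    have "closedin (top_of_set UNIV) K"
      using compact_imp_closed[OF K(1)] by simp
    from Tietze[OF Fg this b] obtain \<phi> where
      \<phi>: "continuous_on UNIV \<phi>" "\<And>u. u \<in> K \<Longrightarrow> \<phi> u = F (g u)" "\<And>u. norm (\<phi> u) \<le> b"
      by auto
    have "measure_pmf.expectation (p n) F = measure_pmf.expectation (p n) (\<lambda>x. \<phi> (\<sigma> x))" for n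
      using \<sigma> p[of n] \<phi>(2) by (intro integral_cong_AE) (auto simp: AE_measure_pmf_iff)
    moreover have "(\<integral>u. \<phi> u \<partial>M') = (\<integral>x. F x \<partial>M)"
    proof -
      have "(\<integral>x. F x \<partial>M) = (\<integral>u. F (g' u) \<partial>M')"
        unfolding M_def using F by (intro integral_distr g' borel_measurable_continuous_onI)
      also have "\<dots> = (\<integral>u. \<phi> u \<partial>M')"
      proof (rule integral_cong_AE)
        show "AE u in M'. F (g' u) = \<phi> u"
          using AE_K by eventually_elim (simp add: g'_def \<phi>)
        show "(\<lambda>u. F (g' u)) \<in> borel_measurable M'"
          using borel_measurable_continuous_onI[OF F] g' by measurable
        show "\<phi> \<in> borel_measurable M'"
          using borel_measurable_continuous_onI[OF \<phi>(1)] by simp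
      qed
      finally show ?thesis by simp
    qed
    ultimately show ?thesis
      using conv[OF \<phi>(1), of b] \<phi>(3) by simp
  qed
  ultimately show ?thesis
    using r(1) by blast
qed

section \<open>Quadrature measures\<close>

text \<open>Each point is sent to a point of a finite \<open>e\<close>-net within distance
  \<open>e\<close>; choosing the first such point in an enumeration is what makes the map
  Borel.\<close>

lemma finite_range_approximation:
  fixes e :: real
  assumes comp: "compact (UNIV :: 'a::metric_space set)" and e: "0 < e"
  shows "\<exists>T :: 'a \<Rightarrow> 'a. finite (range T) \<and> T \<in> borel \<rightarrow>\<^sub>M count_space UNIV \<and> (\<forall>x. dist x (T x) < e)"
proof -
  obtain F :: "'a set" where F: "finite F" "UNIV \<subseteq> (\<Union>x\<in>F. ball x e)"
    by (rule compactE_image[OF comp, of UNIV "\<lambda>x. ball x e"]) (use e in auto)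
  then have "F \<noteq> {}" by auto
  define c where "c = from_nat_into F"
  have c: "range c = F"
    unfolding c_def using F(1) \<open>F \<noteq> {}\<close> by (intro range_from_nat_into countable_finite)
  define i where "i x = (LEAST k. dist x (c k) < e)" for x
  have i: "dist x (c (i x)) < e" for x
  proof -
    have "x \<in> (\<Union>y\<in>F. ball y e)" using F(2) by blast
    then obtain y where "y \<in> F" "dist y x < e" by auto
    then obtain k where "dist x (c k) < e" using c by (metis dist_commute imageE)
    then show ?thesis unfolding i_def by (rule LeastI)
  qed
  have "(\<lambda>x. dist x (c k) < e) \<in> borel \<rightarrow>\<^sub>M count_space UNIV" for k
  proof -
    have "open {x. dist x (c k) < e}"
      by (intro open_Collect_less continuous_intros)
    then show ?thesis by (simp add: pred_def borel_open)
  qed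
  then have i_meas: "i \<in> borel \<rightarrow>\<^sub>M count_space UNIV"
    unfolding i_def by (rule measurable_Least)
  have "(\<lambda>x. c (i x)) \<in> borel \<rightarrow>\<^sub>M count_space UNIV"
    by (rule measurable_compose[OF i_meas]) simp
  moreover have "finite (range (\<lambda>x. c (i x)))"
    by (rule finite_subset[OF _ F(1)]) (use c in blast)
  ultimately show ?thesis
    using i by blast
qed

lemma integral_finite_range:
  fixes f :: "'a \<Rightarrow> real"
  assumes M: "finite_measure M" and T: "T \<in> M \<rightarrow>\<^sub>M count_space UNIV" "finite (range T)"
  shows "(\<integral>x. f (T x) \<partial>M) = (\<Sum>y\<in>range T. measure M (T -` {y} \<inter> space M) * f y)"
proof -
  interpret finite_measure M by fact
  have sets: "T -` {y} \<inter> space M \<in> sets M" for y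
    using T(1) by (rule measurable_sets) simp
  have "f (T x) = (\<Sum>y\<in>range T. indicator (T -` {y} \<inter> space M) x * f y)" if "x \<in> space M" for x
    using T(2) that by (subst sum.remove[of _ "T x"]) (auto intro!: sum.neutral)
  then have "(\<integral>x. f (T x) \<partial>M) = (\<integral>x. (\<Sum>y\<in>range T. indicator (T -` {y} \<inter> space M) x * f y) \<partial>M)"
    by (rule Bochner_Integration.integral_cong[OF refl])
  also have "\<dots> = (\<Sum>y\<in>range T. measure M (T -` {y} \<inter> space M) * f y)"
    using sets by (subst Bochner_Integration.integral_sum) (auto simp: less_top[symmetric])
  finally show ?thesis .
qed

text \<open>The combination is the image under \<open>y\<close> of the discrete measure with masses
  \<open>lam j\<close> on the indices. Coinciding nodes then add up their masses, and integrals
  become sums over indices.\<close>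

lemma convex_dirac_combination_properties:
  assumes \<rho>: "convex_dirac_combination n lam y \<rho>"
  shows "\<rho> \<in> signed_measures" "A \<in> sets borel \<Longrightarrow> 0 \<le> \<rho> A" "\<rho> UNIV = 1"
    and "f \<in> borel_measurable borel \<Longrightarrow> signed_integral \<rho> f = (\<Sum>j=1..n. lam j * f (y j))"
proof -
  have lam: "\<And>j. j \<in> {1..n} \<Longrightarrow> 0 \<le> lam j" "(\<Sum>j=1..n. lam j) = 1"
    and \<rho>_eq: "\<rho> = (\<lambda>A. \<Sum>j=1..n. lam j * measure (return borel (y j)) A)"
    using \<rho> by (auto simp: convex_dirac_combination_def)
  define P where "P = point_measure {1..n} (\<lambda>j. ennreal (lam j))"
  define N where "N = distr P borel y"
  have y_meas: "y \<in> measurable P borel" by (simp add: P_def measurable_point_measure_eq1)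
  have N_em: "emeasure N A = ennreal (\<rho> A)" if A: "A \<in> sets borel" for A
  proof -
    have "emeasure N A = (\<Sum>j\<in>y -` A \<inter> {1..n}. ennreal (lam j))"
      unfolding N_def emeasure_distr[OF y_meas A]
      by (simp add: P_def space_point_measure emeasure_point_measure_finite)
    also have "\<dots> = (\<Sum>j=1..n. ennreal (lam j * indicator A (y j)))"
      by (intro sum.mono_neutral_cong_left) (auto simp: indicator_def)
    also have "\<dots> = ennreal (\<Sum>j=1..n. lam j * indicator A (y j))"
      using lam(1) by (intro sum_ennreal) auto
    also have "(\<Sum>j=1..n. lam j * indicator A (y j)) = \<rho> A"
      unfolding \<rho>_eq using A by (simp add: measure_return)
    finally show ?thesis .
  qed
  have nonneg: "0 \<le> \<rho> A" for A
    unfolding \<rho>_eq using lam(1) by (intro sum_nonneg mult_nonneg_nonneg) auto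
  have sets_N: "sets N = sets borel" by (simp add: N_def)
  have \<rho>_N: "\<rho> = measure N"
  proof
    fix A
    show "\<rho> A = measure N A"
    proof (cases "A \<in> sets borel")
      case True
      then show ?thesis using N_em nonneg by (simp add: measure_def)
    next
      case False
      then show ?thesis by (simp add: \<rho>_eq measure_notin_sets sets_N)
    qed
  qed
  have fin: "finite_measure N"
  proof (rule finite_measureI)
    have "space N = UNIV" by (simp add: N_def)
    then show "emeasure N (space N) \<noteq> \<infinity>" by (simp add: N_em)
  qed
  show "\<rho> \<in> signed_measures"
    unfolding \<rho>_N by (rule measure_in_signed_measures[OF fin sets_N])
  show "0 \<le> \<rho> A" by (rule nonneg)
  show "\<rho> UNIV = 1" using lam(2) by (simp add: \<rho>_eq measure_return)
  assume f: "f \<in> borel_measurable borel"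
  have "signed_integral \<rho> f = (\<integral>x. f x \<partial>N)"
    unfolding \<rho>_N by (rule signed_integral_measure[OF fin sets_N])
  also have "\<dots> = (\<integral>j. f (y j) \<partial>P)"
    unfolding N_def by (rule integral_distr[OF y_meas f])
  also have "\<dots> = (\<Sum>j=1..n. lam j * f (y j))"
    unfolding P_def using lam(1) by (subst lebesgue_integral_point_measure_finite) auto
  finally show "signed_integral \<rho> f = (\<Sum>j=1..n. lam j * f (y j))" .
qed

section \<open>Parametrization by weights and nodes\<close>

text \<open>Indexing by all of \<open>nat\<close> places the parameters in a countable product,
  which is a metric space whenever the node space is. The bound on every weight, also outside
  \<open>1..n\<close>, serves the compactness of the product.\<close>

definition node_parameters :: "nat \<Rightarrow> ((nat \<Rightarrow> real) \<times> (nat \<Rightarrow> 'a)) set" where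
  "node_parameters n = {z. (\<forall>j. fst z j \<in> {0..1}) \<and> (\<Sum>j=1..n. fst z j) = 1}"

definition node_sum :: "nat \<Rightarrow> ('a \<Rightarrow> real) \<Rightarrow> (nat \<Rightarrow> real) \<times> (nat \<Rightarrow> 'a) \<Rightarrow> real" where
  "node_sum n f z = (\<Sum>j=1..n. fst z j * f (snd z j))"

definition node_measure ::
    "nat \<Rightarrow> (nat \<Rightarrow> real) \<times> (nat \<Rightarrow> 'a::topological_space) \<Rightarrow> 'a set \<Rightarrow> real" where
  "node_measure n z = (\<lambda>A. \<Sum>j=1..n. fst z j * measure (return borel (snd z j)) A)"

lemma convex_dirac_combination_node_measure:
  "z \<in> node_parameters n \<Longrightarrow> convex_dirac_combination n (fst z) (snd z) (node_measure n z)"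
  by (simp add: convex_dirac_combination_def node_parameters_def node_measure_def)

text \<open>A representation constrains only the weights in \<open>1..n\<close>, so all others are
  reset to 0; those in range are at most 1, being nonnegative with sum 1.\<close>

lemma convex_dirac_combination_obtains_parameters:
  assumes "convex_dirac_combination n lam y \<rho>"
  obtains z where "z \<in> node_parameters n" "\<rho> = node_measure n z"
proof -
  have lam: "\<And>j. j \<in> {1..n} \<Longrightarrow> 0 \<le> lam j" "(\<Sum>j=1..n. lam j) = 1"
    and \<rho>_eq: "\<rho> = (\<lambda>A. \<Sum>j=1..n. lam j * measure (return borel (y j)) A)"
    using assms by (auto simp: convex_dirac_combination_def)
  have le1: "lam j \<le> 1" if "j \<in> {1..n}" for j
    using member_le_sum[of j "{1..n}" lam] that lam by auto
  define z where "z = (\<lambda>j. if j \<in> {1..n} then lam j else 0, y)"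
  have "z \<in> node_parameters n"
    using lam le1 by (simp add: z_def node_parameters_def)
  moreover have "\<rho> = node_measure n z"
    by (simp add: \<rho>_eq node_measure_def z_def)
  ultimately show ?thesis by (rule that)
qed

lemma node_sum_add: "node_sum n (\<lambda>x. f x + g x) z = node_sum n f z + node_sum n g z"
  by (simp add: node_sum_def distrib_left sum.distrib)

lemma node_sum_mult: "node_sum n (\<lambda>x. c * f x) z = c * node_sum n f z"
  by (simp add: node_sum_def sum_distrib_left mult.left_commute)

lemma continuous_on_node_sum:
  fixes f :: "'a::topological_space \<Rightarrow> real"
  assumes "continuous_on UNIV f"
  shows "continuous_on S (node_sum n f)"
proof -
  have "continuous_on S (\<lambda>z. fst z j :: real)" for j and S :: "((nat \<Rightarrow> real) \<times> (nat \<Rightarrow> 'a)) set"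
    by (intro continuous_on_product_then_coordinatewise[of _ fst] continuous_intros)
  moreover have "continuous_on S (\<lambda>z. snd z j)" for j and S :: "((nat \<Rightarrow> real) \<times> (nat \<Rightarrow> 'a)) set"
    by (intro continuous_on_product_then_coordinatewise[of _ snd] continuous_intros)
  ultimately show ?thesis
    unfolding node_sum_def
    by (intro continuous_intros continuous_on_compose2[OF assms]) auto
qed

lemma compact_node_parameters:
  assumes "compact (UNIV :: 'a::topological_space set)"
  shows "compact (node_parameters n :: ((nat \<Rightarrow> real) \<times> (nat \<Rightarrow> 'a)) set)"
proof -
  have "compact ({l. \<forall>j. l j \<in> {0..1::real}} \<times> {y :: nat \<Rightarrow> 'a. \<forall>j. y j \<in> UNIV})"
    using assms by (intro compact_Times compact_Pi_UNIV) auto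
  moreover have "closed {z :: (nat \<Rightarrow> real) \<times> (nat \<Rightarrow> 'a). node_sum n (\<lambda>_. 1) z = 1}"
    by (intro closed_Collect_eq continuous_on_node_sum continuous_intros)
  ultimately have "compact ({l. \<forall>j. l j \<in> {0..1::real}} \<times> {y :: nat \<Rightarrow> 'a. \<forall>j. y j \<in> UNIV} \<inter>
      {z. node_sum n (\<lambda>_. 1) z = 1})"
    by (rule compact_Int_closed)
  also have "{l. \<forall>j. l j \<in> {0..1::real}} \<times> {y :: nat \<Rightarrow> 'a. \<forall>j. y j \<in> UNIV} \<inter>
      {z. node_sum n (\<lambda>_. 1) z = 1} = node_parameters n"
    by (auto simp: node_parameters_def node_sum_def)
  finally show ?thesis .
qed

lemma node_sum_bound:
  assumes z: "z \<in> node_parameters n" and f: "\<And>x. \<bar>f x\<bar> \<le> b"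
  shows "\<bar>node_sum n f z\<bar> \<le> b"
proof -
  have "\<bar>node_sum n f z\<bar> \<le> (\<Sum>j=1..n. \<bar>fst z j * f (snd z j)\<bar>)"
    unfolding node_sum_def by (rule sum_abs)
  also have "\<dots> \<le> (\<Sum>j=1..n. fst z j * b)"
    using z f by (intro sum_mono) (auto simp: node_parameters_def abs_mult intro!: mult_mono)
  also have "\<dots> = b"
    using z by (simp add: node_parameters_def sum_distrib_right[symmetric])
  finally show ?thesis .
qed

lemma signed_integral_node_measure:
  fixes f :: "'a::metric_space \<Rightarrow>\<^sub>C real"
  assumes "z \<in> node_parameters n"
  shows "signed_integral (node_measure n z) f = node_sum n f z"
proof -
  have "apply_bcontfun f \<in> borel_measurable borel"
    by (intro borel_measurable_continuous_onI continuous_on_apply_bcontfun)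
  from convex_dirac_combination_properties(4)[OF convex_dirac_combination_node_measure[OF assms] this]
  show ?thesis by (simp add: node_sum_def)
qed

text \<open>Only generating sets have to be pulled back, and on parameters evaluation at
  \<open>f\<close> becomes \<open>node_sum n f\<close>, a finite sum of continuous functions of the
  coordinates.\<close>

lemma continuous_map_node_measure:
  "continuous_map (top_of_set (node_parameters n)) weak_star_topology
     (node_measure n :: _ \<Rightarrow> 'a::metric_space set \<Rightarrow> real)"
  unfolding weak_star_topology_def
proof (rule continuous_on_generated_topo)
  have mem: "node_measure n z \<in> signed_measures" if "z \<in> node_parameters n"
    for z :: "(nat \<Rightarrow> real) \<times> (nat \<Rightarrow> 'a)"
    using convex_dirac_combination_properties(1)[OF convex_dirac_combination_node_measure[OF that]] .
  show "openin (top_of_set (node_parameters n)) (node_measure n -` W \<inter> topspace (top_of_set (node_parameters n)))"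
    if W: "W \<in> {{s \<in> signed_measures. signed_integral s (apply_bcontfun f) \<in> U} |
      (f :: 'a \<Rightarrow>\<^sub>C real) U. open U}" for W
  proof -
    obtain f :: "'a \<Rightarrow>\<^sub>C real" and U where
      fU: "W = {s \<in> signed_measures. signed_integral s f \<in> U}" "open U"
      using W by blast
    have "node_measure n -` W \<inter> topspace (top_of_set (node_parameters n)) =
        node_parameters n \<inter> node_sum n f -` U"
      using mem by (auto simp: fU(1) signed_integral_node_measure)
    moreover have "openin (top_of_set (node_parameters n)) (node_parameters n \<inter> node_sum n f -` U)"
      by (rule continuous_openin_preimage_gen[OF _ fU(2)])
        (intro continuous_on_node_sum continuous_on_apply_bcontfun)
    ultimately show ?thesis by simp
  qed
  show "node_measure n ` topspace (top_of_set (node_parameters n)) \<subseteq>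
      \<Union> {{s \<in> signed_measures. signed_integral s (apply_bcontfun f) \<in> U} |
        (f :: 'a \<Rightarrow>\<^sub>C real) U. open U}"
    using mem by (auto intro!: exI[of _ UNIV])
qed

text \<open>Positivity and total mass 1 come with the parameters, so what remains of the definition
  are the moment equations, which are closed conditions on a compact set.\<close>

lemma quadrature_measures_eq_image:
  "quadrature_measures \<mu> X m = node_measure (m + 2) `
     {z \<in> node_parameters (m + 2). \<forall>f\<in>X. node_sum (m + 2) f z = (\<integral>x. f x \<partial>\<mu>)}"
proof (intro equalityI subsetI)
  fix \<rho> assume \<rho>: "\<rho> \<in> quadrature_measures \<mu> X m"
  then obtain lam y where "convex_dirac_combination (m + 2) lam y \<rho>"
    by (auto simp: quadrature_measures_def)
  then obtain z where z: "z \<in> node_parameters (m + 2)" "\<rho> = node_measure (m + 2) z"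
    by (rule convex_dirac_combination_obtains_parameters)
  with \<rho> show "\<rho> \<in> node_measure (m + 2) `
     {z \<in> node_parameters (m + 2). \<forall>f\<in>X. node_sum (m + 2) f z = (\<integral>x. f x \<partial>\<mu>)}"
    by (auto simp: quadrature_measures_def signed_integral_node_measure)
next
  fix \<rho> assume "\<rho> \<in> node_measure (m + 2) `
     {z \<in> node_parameters (m + 2). \<forall>f\<in>X. node_sum (m + 2) f z = (\<integral>x. f x \<partial>\<mu>)}"
  then obtain z where z: "z \<in> node_parameters (m + 2)" "\<rho> = node_measure (m + 2) z"
    "\<forall>f\<in>X. node_sum (m + 2) f z = (\<integral>x. f x \<partial>\<mu>)" by blast
  note \<rho> = convex_dirac_combination_node_measure[OF z(1), folded z(2)]
  then show "\<rho> \<in> quadrature_measures \<mu> X m"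
    using convex_dirac_combination_properties(1-3)[OF \<rho>] z
    by (auto simp: quadrature_measures_def signed_integral_node_measure)
qed

lemma closedin_quadrature_measures:
  fixes \<mu> :: "'a::metric_space measure"
  assumes comp: "compact (UNIV :: 'a set)"
  shows "closedin weak_star_topology (quadrature_measures \<mu> X m)"
proof -
  let ?P = "node_parameters (m + 2) :: ((nat \<Rightarrow> real) \<times> (nat \<Rightarrow> 'a)) set"
  let ?Z = "{z. \<forall>f\<in>X. node_sum (m + 2) f z = (\<integral>x. f x \<partial>\<mu>)}"
  have "?Z = (\<Inter>f\<in>X. {z. node_sum (m + 2) (apply_bcontfun f) z = (\<integral>x. f x \<partial>\<mu>)})" by blast
  then have "closed ?Z"
    by (simp only:) (intro closed_INT ballI closed_Collect_eq continuous_on_node_sum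
        continuous_on_apply_bcontfun continuous_intros)
  then have "compactin (top_of_set ?P) (?P \<inter> ?Z)"
    using compact_Int_closed[OF compact_node_parameters[OF comp]] by (simp add: compactin_subtopology)
  then have "compactin weak_star_topology (node_measure (m + 2) ` (?P \<inter> ?Z))"
    using continuous_map_node_measure by (rule image_compactin)
  moreover have "?P \<inter> ?Z = {z \<in> ?P. \<forall>f\<in>X. node_sum (m + 2) f z = (\<integral>x. f x \<partial>\<mu>)}"
    by blast
  ultimately show ?thesis
    unfolding quadrature_measures_eq_image
    by (intro compactin_imp_closedin Hausdorff_weak_star_topology) simp
qed

text \<open>The support is enumerated by \<open>h\<close> and padded with zero weights up to
  \<open>n\<close>; the nodes of the padding are whatever values \<open>h\<close> has there.\<close>

lemma node_parameters_of_weight: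
  fixes v :: "'a \<Rightarrow> real"
  assumes S: "finite S" and v: "\<And>y. 0 \<le> v y" "sum v S = 1" and card: "card {y \<in> S. v y \<noteq> 0} \<le> n"
  shows "\<exists>z\<in>node_parameters n. \<forall>f. node_sum n f z = (\<Sum>y\<in>S. v y * f y)"
proof -
  define A where "A = {y \<in> S. v y \<noteq> 0}"
  have A: "finite A" "A \<subseteq> S" using S by (auto simp: A_def)
  obtain h where h: "bij_betw h {1..card A} A"
    using ex_bij_betw_nat_finite_1[OF A(1)] by blast
  define z where "z = (\<lambda>j. if j \<in> {1..card A} then v (h j) else 0, h)"
  have sum: "node_sum n f z = (\<Sum>y\<in>S. v y * f y)" for f
  proof -
    have "node_sum n f z = (\<Sum>j=1..card A. v (h j) * f (h j))"
      unfolding node_sum_def z_def using card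
      by (intro sum.mono_neutral_cong_right) (auto simp: A_def[symmetric])
    also have "\<dots> = (\<Sum>y\<in>A. v y * f y)"
      by (rule sum.reindex_bij_betw[OF h])
    also have "\<dots> = (\<Sum>y\<in>S. v y * f y)"
      using S by (intro sum.mono_neutral_left) (auto simp: A_def)
    finally show ?thesis .
  qed
  have le1: "v (h j) \<le> 1" if "j \<in> {1..card A}" for j
  proof -
    have "h j \<in> S" using bij_betwE[OF h] that A(2) by blast
    then show ?thesis using member_le_sum[of "h j" S v] v S by simp
  qed
  have "(\<Sum>j=1..n. fst z j) = 1"
    using sum[of "\<lambda>_. 1"] v(2) by (simp add: node_sum_def)
  then have "z \<in> node_parameters n"
    using v(1) le1 by (auto simp: node_parameters_def z_def)
  then show ?thesis using sum by blast
qed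

text \<open>The image of \<mu> under \<open>T\<close> is a weight on a finite set, so the
  moment-preserving decomposition applies. The second claim allows arbitrary \<open>f\<close>
  because all integrals are finite sums; the third says that the moments against \<open>B\<close>
  are right at each summand and not only in the mean.\<close>

lemma discretized_representation:
  fixes \<mu> :: "'a::metric_space measure" and B :: "('a \<Rightarrow>\<^sub>C real) set"
  assumes \<mu>: "prob_space \<mu>" "sets \<mu> = sets borel"
    and T: "T \<in> borel \<rightarrow>\<^sub>M count_space UNIV" "finite (range T)"
    and B: "finite B"
  shows "\<exists>p. set_pmf p \<subseteq> node_parameters (card B + 2) \<and>
    (\<forall>f. measure_pmf.expectation p (node_sum (card B + 2) f) = (\<integral>x. f (T x) \<partial>\<mu>)) \<and>
    (\<forall>g\<in>B. \<forall>z\<in>set_pmf p. node_sum (card B + 2) g z = (\<integral>x. g (T x) \<partial>\<mu>))"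
proof -
  interpret prob_space \<mu> by fact
  have sp: "space \<mu> = UNIV" using sets_eq_imp_space_eq[OF \<mu>(2)] by simp
  have T\<mu>: "T \<in> \<mu> \<rightarrow>\<^sub>M count_space UNIV"
    using T(1) by (simp add: measurable_cong_sets[OF \<mu>(2) refl])
  define S where "S = range T"
  define w where "w y = measure \<mu> (T -` {y})" for y
  let ?n = "card B + 2"
  have int: "(\<integral>x. f (T x) \<partial>\<mu>) = (\<Sum>y\<in>S. w y * f y)" for f
    using integral_finite_range[OF finite_measure_axioms T\<mu> T(2), of f] by (simp add: sp S_def w_def)
  have w0: "w y = 0" if "y \<notin> S" for y
  proof -
    have "T -` {y} = {}" using that by (auto simp: S_def)
    then show ?thesis by (simp add: w_def)
  qed
  have S: "finite S" using T by (simp add: S_def)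
  have w1: "sum w S = 1" using int[of "\<lambda>_. 1"] prob_space by (simp add: sp)
  define G where "G = apply_bcontfun ` B"
  have G: "finite G" "card G \<le> card B" using B by (auto simp: G_def card_image_le)
  obtain P where P: "finite (set_pmf P)"
    "\<And>v. v \<in> set_pmf P \<Longrightarrow> (\<forall>y. 0 \<le> v y) \<and> sum v S = 1 \<and> card {y \<in> S. v y \<noteq> 0} \<le> card G + 1 \<and>
      (\<forall>g\<in>G. (\<Sum>y\<in>S. v y * g y) = (\<Sum>y\<in>S. w y * g y))"
    "\<And>y. measure_pmf.expectation P (\<lambda>v. v y) = w y"
    using moment_preserving_decomposition[OF G(1) S, of w] w0 w1 by (auto simp: w_def)
  have "\<exists>z\<in>node_parameters ?n. \<forall>f. node_sum ?n f z = (\<Sum>y\<in>S. v y * f y)"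
    if "v \<in> set_pmf P" for v
    \<comment> \<open>At most \<open>card G + 1\<close> atoms, hence at most
      \<open>card B + 1\<close>, have to fit into \<open>card B + 2\<close> nodes.\<close>
    using P(2)[OF that] G(2) by (intro node_parameters_of_weight S) auto
  then obtain \<psi> where \<psi>: "\<And>v. v \<in> set_pmf P \<Longrightarrow> \<psi> v \<in> node_parameters ?n"
    "\<And>v f. v \<in> set_pmf P \<Longrightarrow> node_sum ?n f (\<psi> v) = (\<Sum>y\<in>S. v y * f y)"
    by metis
  define p where "p = map_pmf \<psi> P"
  have "set_pmf p \<subseteq> node_parameters ?n"
    using \<psi>(1) by (auto simp: p_def)
  moreover have "measure_pmf.expectation p (node_sum ?n f) = (\<integral>x. f (T x) \<partial>\<mu>)" for f
  proof -
    have "measure_pmf.expectation p (node_sum ?n f) =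
        measure_pmf.expectation P (\<lambda>v. node_sum ?n f (\<psi> v))"
      by (simp add: p_def)
    also have "\<dots> = measure_pmf.expectation P (\<lambda>v. \<Sum>y\<in>S. v y * f y)"
      using \<psi>(2) by (intro integral_cong_AE) (auto simp: AE_measure_pmf_iff)
    also have "\<dots> = (\<Sum>y\<in>S. measure_pmf.expectation P (\<lambda>v. v y) * f y)"
      using P(1) by (subst Bochner_Integration.integral_sum) (auto intro: integrable_measure_pmf_finite)
    finally show ?thesis by (simp add: P(3) int)
  qed
  moreover have "node_sum ?n g z = (\<integral>x. g (T x) \<partial>\<mu>)" if g: "g \<in> B" and z: "z \<in> set_pmf p" for g z
  proof -
    obtain v where "v \<in> set_pmf P" "z = \<psi> v"
      using z unfolding p_def set_map_pmf by blast
    then show ?thesis using P(2)[of v] \<psi>(2) g by (auto simp: G_def int)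
  qed
  ultimately show ?thesis by blast
qed

section \<open>The weak limit of the parameter laws and the measure \<nu>\<close>

theorem theorem3p1:
  fixes \<mu> :: "'a::metric_space measure"
    and X :: "('a \<Rightarrow>\<^sub>C real) set"
    and m :: nat
  assumes "compact (UNIV :: 'a set)"
    and "prob_space \<mu>" and "sets \<mu> = sets borel"
    and "subspace X"
    and "\<exists>B. finite B \<and> independent B \<and> span B = X \<and> card B = m"
  shows "\<exists>\<nu> :: ('a set \<Rightarrow> real) measure.
           prob_space \<nu> \<and> sets \<nu> = sets weak_star_borel \<and>
           quadrature_measures \<mu> X m \<in> sets \<nu> \<and>
           emeasure \<nu> (space \<nu> - quadrature_measures \<mu> X m) = 0 \<and>
           (\<forall>lam y. (\<forall>\<rho>\<in>quadrature_measures \<mu> X m.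
                        convex_dirac_combination (m + 2) (lam \<rho>) (y \<rho>) \<rho>) \<longrightarrow>
              (\<forall>f :: 'a \<Rightarrow>\<^sub>C real.
                 set_integrable \<nu> (quadrature_measures \<mu> X m)
                   (\<lambda>\<rho>. \<Sum>j=1..m+2. lam \<rho> j * apply_bcontfun f (y \<rho> j)) \<and>
                 (\<integral>x. apply_bcontfun f x \<partial>\<mu>) =
                   (LINT \<rho>:quadrature_measures \<mu> X m|\<nu>.
                      \<Sum>j=1..m+2. lam \<rho> j * apply_bcontfun f (y \<rho> j))))"
proof -
  let ?n = "m + 2"
  let ?\<Sigma> = "quadrature_measures \<mu> X m"
  let ?P = "node_parameters ?n :: ((nat \<Rightarrow> real) \<times> (nat \<Rightarrow> 'a)) set"
  interpret \<mu>: prob_space \<mu> by fact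
  obtain B where B: "finite B" "span B = X" "card B = m" using assms(5) by blast
  note bmeas = borel_measurable_continuous_onI[OF continuous_on_apply_bcontfun]
  have bnd: "\<bar>f x\<bar> \<le> norm f" for f :: "'a \<Rightarrow>\<^sub>C real" and x
    using norm_bounded[of f x] by simp

  have "\<forall>n. \<exists>T :: 'a \<Rightarrow> 'a. finite (range T) \<and> T \<in> borel \<rightarrow>\<^sub>M count_space UNIV \<and>
      (\<forall>x. dist x (T x) < 1 / real (Suc n))"
    by (intro allI finite_range_approximation assms(1)) simp
  then obtain T :: "nat \<Rightarrow> 'a \<Rightarrow> 'a" where T: "\<And>n. finite (range (T n))"
    "\<And>n. T n \<in> borel \<rightarrow>\<^sub>M count_space UNIV" "\<And>n x. dist x (T n x) < 1 / real (Suc n)"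
    by metis
  have T_lim: "(\<lambda>n. \<integral>x. f (T n x) \<partial>\<mu>) \<longlonglongrightarrow> (\<integral>x. f x \<partial>\<mu>)" for f :: "'a \<Rightarrow>\<^sub>C real"
  proof (rule integral_dominated_convergence[where w = "\<lambda>_. norm f"])
    show "(\<lambda>x. f (T n x)) \<in> borel_measurable \<mu>" for n
      unfolding measurable_cong_sets[OF assms(3) refl]
      by (rule measurable_compose[OF T(2)]) simp
    show "apply_bcontfun f \<in> borel_measurable \<mu>"
      unfolding measurable_cong_sets[OF assms(3) refl] by (rule bmeas)
    show "AE x in \<mu>. (\<lambda>n. f (T n x)) \<longlonglongrightarrow> f x"
    proof (rule AE_I2)
      fix x
      have "(\<lambda>n. dist (T n x) x) \<longlonglongrightarrow> 0"
        by (rule Lim_null_comparison[OF _ LIMSEQ_inverse_real_of_nat])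
          (use T(3) in \<open>auto simp: dist_commute inverse_eq_divide less_imp_le\<close>)
      then have "(\<lambda>n. T n x) \<longlonglongrightarrow> x" by (rule tendsto_dist_iff[THEN iffD2])
      then show "(\<lambda>n. f (T n x)) \<longlonglongrightarrow> f x"
        by (rule continuous_on_tendsto_compose[OF continuous_on_apply_bcontfun[of UNIV f]]) auto
    qed
  qed (auto simp: bnd)

  have "\<forall>n. \<exists>p. set_pmf p \<subseteq> ?P \<and>
    (\<forall>f. measure_pmf.expectation p (node_sum ?n f) = (\<integral>x. f (T n x) \<partial>\<mu>)) \<and>
    (\<forall>g\<in>B. \<forall>z\<in>set_pmf p. node_sum ?n g z = (\<integral>x. g (T n x) \<partial>\<mu>))"
    using discretized_representation[OF assms(2,3) T(2) T(1) B(1)] B(3) by simp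
  then obtain p where p: "\<And>n. set_pmf (p n) \<subseteq> ?P"
    "\<And>n f. measure_pmf.expectation (p n) (node_sum ?n f) = (\<integral>x. f (T n x) \<partial>\<mu>)"
    "\<And>n g z. g \<in> B \<Longrightarrow> z \<in> set_pmf (p n) \<Longrightarrow> node_sum ?n g z = (\<integral>x. g (T n x) \<partial>\<mu>)"
    by metis
  obtain r M where r: "strict_mono (r :: nat \<Rightarrow> nat)"
    and M: "prob_space M" "sets M = sets borel" "AE z in M. z \<in> ?P"
    and conv: "\<And>F :: _ \<Rightarrow> real. continuous_on UNIV F \<Longrightarrow>
      (\<lambda>n. measure_pmf.expectation (p (r n)) F) \<longlonglongrightarrow> (\<integral>z. F z \<partial>M)"
    using compact_pmf_weakly_convergent_subsequence[of ?P p, OF compact_node_parameters[OF assms(1)] p(1)]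
    by blast
  interpret M: prob_space M by fact
  have node_meas: "node_sum ?n f \<in> borel_measurable M" for f :: "'a \<Rightarrow>\<^sub>C real"
    unfolding measurable_cong_sets[OF M(2) refl]
    by (intro borel_measurable_continuous_onI continuous_on_node_sum continuous_on_apply_bcontfun)
  have M_int: "(\<integral>z. node_sum ?n f z \<partial>M) = (\<integral>x. f x \<partial>\<mu>)" for f :: "'a \<Rightarrow>\<^sub>C real"
  \<comment> \<open>One sequence with two limits: the weak limit on parameters, and the limit of the
    discretized integrals, which the mean over \<open>p n\<close> reproduces exactly.\<close>
  proof (rule LIMSEQ_unique)
    show "(\<lambda>n. measure_pmf.expectation (p (r n)) (node_sum ?n f)) \<longlonglongrightarrow> (\<integral>z. node_sum ?n f z \<partial>M)"
      by (intro conv continuous_on_node_sum continuous_on_apply_bcontfun)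
    show "(\<lambda>n. measure_pmf.expectation (p (r n)) (node_sum ?n f)) \<longlonglongrightarrow> (\<integral>x. f x \<partial>\<mu>)"
      using LIMSEQ_subseq_LIMSEQ[OF T_lim r, of f] unfolding p(2) o_def .
  qed
  have moment: "AE z in M. node_sum ?n g z = (\<integral>x. g x \<partial>\<mu>)" if g: "g \<in> B" for g
  proof -
    \<comment> \<open>On \<open>set_pmf (p n)\<close> the defect is constant, namely the
      discretization error of the moment. The modulus prevents defects of opposite sign from
      cancelling in the limit.\<close>
    let ?F = "\<lambda>z. \<bar>node_sum ?n g z - (\<integral>x. g x \<partial>\<mu>)\<bar>"
    have "(\<lambda>n. measure_pmf.expectation (p (r n)) ?F) \<longlonglongrightarrow> (\<integral>z. ?F z \<partial>M)"
      by (intro conv continuous_intros continuous_on_node_sum continuous_on_apply_bcontfun)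
    moreover have "measure_pmf.expectation (p n) ?F = \<bar>(\<integral>x. g (T n x) \<partial>\<mu>) - (\<integral>x. g x \<partial>\<mu>)\<bar>" for n
    proof -
      have "measure_pmf.expectation (p n) ?F =
          measure_pmf.expectation (p n) (\<lambda>_. \<bar>(\<integral>x. g (T n x) \<partial>\<mu>) - (\<integral>x. g x \<partial>\<mu>)\<bar>)"
        using p(3)[OF g] by (intro integral_cong_AE) (auto simp: AE_measure_pmf_iff)
      then show ?thesis by simp
    qed
    moreover have "(\<lambda>n. \<bar>(\<integral>x. g (T (r n) x) \<partial>\<mu>) - (\<integral>x. g x \<partial>\<mu>)\<bar>) \<longlonglongrightarrow> 0"
      using LIMSEQ_subseq_LIMSEQ[OF T_lim r, of g]
      by (intro tendsto_rabs_zero LIM_zero) (simp add: o_def)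
    ultimately have "(\<integral>z. ?F z \<partial>M) = 0"
      using LIMSEQ_unique by fastforce
    moreover have "integrable M ?F"
    proof (rule M.integrable_const_bound[where B = "norm g + \<bar>\<integral>x. g x \<partial>\<mu>\<bar>"])
      show "AE z in M. norm (?F z) \<le> norm g + \<bar>\<integral>x. g x \<partial>\<mu>\<bar>"
        using M(3)
      proof eventually_elim
        case (elim z)
        have "\<bar>node_sum ?n g z\<bar> \<le> norm g" by (rule node_sum_bound[OF elim bnd])
        then show ?case unfolding real_norm_def by linarith
      qed
      show "?F \<in> borel_measurable M" using node_meas[of g] by measurable
    qed
    ultimately have "AE z in M. ?F z = 0"
      by (subst (asm) integral_nonneg_eq_0_iff_AE) auto
    then show ?thesis by simp
  qed
  \<comment> \<open>Exceptional null sets are collected over the finite basis \<open>B\<close>;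
    then, for each fixed \<open>z\<close>, the functions satisfying the moment equation form a
    subspace, which contains the span of \<open>B\<close>.\<close>
  have moments: "AE z in M. z \<in> ?P \<and> (\<forall>f\<in>X. node_sum ?n f z = (\<integral>x. f x \<partial>\<mu>))"
  proof -
    have "AE z in M. \<forall>g\<in>B. node_sum ?n g z = (\<integral>x. g x \<partial>\<mu>)"
      using B(1) moment by (intro AE_finite_allI) auto
    with M(3) show ?thesis
    proof eventually_elim
      case (elim z)
      have "subspace {f :: 'a \<Rightarrow>\<^sub>C real. node_sum ?n f z = (\<integral>x. f x \<partial>\<mu>)}"
        using finite_measure_integrable_bcontfun[OF \<mu>.finite_measure_axioms assms(3)]
        by (auto simp: subspace_def node_sum_add node_sum_mult) (simp add: node_sum_def)
      then have "X \<subseteq> {f :: 'a \<Rightarrow>\<^sub>C real. node_sum ?n f z = (\<integral>x. f x \<partial>\<mu>)}"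
        unfolding B(2)[symmetric] using elim(2) by (intro span_minimal) auto
      with elim(1) show ?case by blast
    qed
  qed

  obtain z0 where z0: "z0 \<in> ?P"
    using p(1)[of 0] set_pmf_not_empty[of "p 0"] by blast
  \<comment> \<open>Continuity of \<open>node_measure\<close> is at hand on \<open>?P\<close>;
    outside this set, which is null for \<open>M\<close>, \<Phi> takes the constant value at
    \<open>z0\<close>.\<close>
  define \<Phi> where "\<Phi> z = node_measure ?n (if z \<in> ?P then z else z0)" for z
  have \<Phi>_mem: "\<Phi> z \<in> signed_measures" for z
    unfolding \<Phi>_def using z0
    by (intro convex_dirac_combination_properties(1)[OF convex_dirac_combination_node_measure]) auto
  have P_closed: "closed ?P"
    by (intro compact_imp_closed compact_node_parameters assms)
  have \<Phi>_meas: "\<Phi> \<in> M \<rightarrow>\<^sub>M weak_star_borel"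
    unfolding weak_star_borel_def
  proof (rule measurable_measure_of)
    show "{U. openin weak_star_topology U} \<subseteq> Pow (signed_measures :: ('a set \<Rightarrow> real) set)"
      using openin_subset by fastforce
    show "\<Phi> \<in> space M \<rightarrow> signed_measures" using \<Phi>_mem by simp
    fix U :: "('a set \<Rightarrow> real) set" assume "U \<in> {U. openin weak_star_topology U}"
    then have "openin (top_of_set ?P) {z \<in> topspace (top_of_set ?P). node_measure ?n z \<in> U}"
      using continuous_map_node_measure by (intro openin_continuous_map_preimage) auto
    then obtain V where V: "open V" "{z \<in> ?P. node_measure ?n z \<in> U} = ?P \<inter> V"
      by (auto simp: openin_open)
    \<comment> \<open>Outside \<open>?P\<close> the preimage is everything or nothing, depending on
      the value at \<open>z0\<close>.\<close>
    have "\<Phi> -` U = (?P \<inter> V) \<union> (if node_measure ?n z0 \<in> U then - ?P else {})"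
      unfolding V(2)[symmetric] by (auto simp: \<Phi>_def split: if_splits)
    also have "\<dots> \<in> sets borel" using V(1) P_closed by auto
    finally show "\<Phi> -` U \<inter> space M \<in> sets M"
      using M(2) sets_eq_imp_space_eq[OF M(2)] by simp
  qed
  define \<nu> where "\<nu> = distr M weak_star_borel \<Phi>"
  have \<nu>: "prob_space \<nu>" "sets \<nu> = sets weak_star_borel"
    by (auto simp: \<nu>_def intro!: M.prob_space_distr \<Phi>_meas)
  interpret \<nu>: prob_space \<nu> by fact
  have \<Sigma>_sets: "?\<Sigma> \<in> sets weak_star_borel"
    by (intro closedin_weak_star_borel closedin_quadrature_measures assms)
  have \<Sigma>_AE: "AE \<rho> in \<nu>. \<rho> \<in> ?\<Sigma>"
  proof -
    have "AE z in M. \<Phi> z \<in> ?\<Sigma>"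
      using moments by eventually_elim (auto simp: \<Phi>_def quadrature_measures_eq_image)
    moreover have "{\<rho> \<in> space weak_star_borel. \<rho> \<in> ?\<Sigma>} \<in> sets weak_star_borel"
      using sets.Int[OF sets.top \<Sigma>_sets] by (simp add: Int_def)
    ultimately show ?thesis
      unfolding \<nu>_def using AE_distr_iff[OF \<Phi>_meas, of "\<lambda>\<rho>. \<rho> \<in> ?\<Sigma>"] by metis
  qed
  have null: "emeasure \<nu> (space \<nu> - ?\<Sigma>) = 0"
    using \<Sigma>_AE \<Sigma>_sets \<nu>(2)
    by (subst (asm) AE_iff_measurable[of "space \<nu> - ?\<Sigma>"]) auto
  have rep: "set_integrable \<nu> ?\<Sigma> (\<lambda>\<rho>. \<Sum>j=1..?n. lam \<rho> j * f (y \<rho> j)) \<and>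
      (\<integral>x. f x \<partial>\<mu>) = (LINT \<rho>:?\<Sigma>|\<nu>. \<Sum>j=1..?n. lam \<rho> j * f (y \<rho> j))"
    if ly: "\<forall>\<rho>\<in>?\<Sigma>. convex_dirac_combination ?n (lam \<rho>) (y \<rho>) \<rho>" for lam y and f :: "'a \<Rightarrow>\<^sub>C real"
  proof -
    let ?I = "\<lambda>\<rho>. signed_integral \<rho> f"
    \<comment> \<open>All representations of \<rho> give the same sum, the integral of
      \<open>f\<close> against \<rho>. Arbitrary, possibly nonmeasurable choices of
      \<open>lam\<close> and \<open>y\<close> are thereby replaced by a measurable
      integrand.\<close>
    have eq: "(\<Sum>j=1..?n. lam \<rho> j * f (y \<rho> j)) = ?I \<rho>" if "\<rho> \<in> ?\<Sigma>" for \<rho>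
      using convex_dirac_combination_properties(4)[OF ly[rule_format, OF that] bmeas] by simp
    have ind: "(\<lambda>\<rho>. indicator ?\<Sigma> \<rho> *\<^sub>R (\<Sum>j=1..?n. lam \<rho> j * f (y \<rho> j))) =
        (\<lambda>\<rho>. indicator ?\<Sigma> \<rho> *\<^sub>R ?I \<rho>)"
      using eq by (auto simp: indicator_def)
    have I_meas: "?I \<in> borel_measurable \<nu>"
      unfolding measurable_cong_sets[OF \<nu>(2) refl] by (rule measurable_signed_integral)
    have "integrable \<nu> (\<lambda>\<rho>. indicator ?\<Sigma> \<rho> *\<^sub>R ?I \<rho>)"
    proof (rule \<nu>.integrable_const_bound[where B = "norm f"])
      show "AE \<rho> in \<nu>. norm (indicator ?\<Sigma> \<rho> *\<^sub>R ?I \<rho>) \<le> norm f"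
        using \<Sigma>_AE
      proof eventually_elim
        case (elim \<rho>)
        then obtain z where "z \<in> ?P" "\<rho> = node_measure ?n z"
          by (auto simp: quadrature_measures_eq_image)
        moreover from this have "\<bar>node_sum ?n f z\<bar> \<le> norm f"
          by (intro node_sum_bound bnd)
        ultimately show ?case
          using elim by (simp add: signed_integral_node_measure)
      qed
      show "(\<lambda>\<rho>. indicator ?\<Sigma> \<rho> *\<^sub>R ?I \<rho>) \<in> borel_measurable \<nu>"
        using \<Sigma>_sets \<nu>(2) I_meas by (intro borel_measurable_scaleR borel_measurable_indicator) auto
    qed
    moreover have "(\<integral>\<rho>. indicator ?\<Sigma> \<rho> *\<^sub>R ?I \<rho> \<partial>\<nu>) = (\<integral>x. f x \<partial>\<mu>)"
    proof -
      have "(\<integral>\<rho>. indicator ?\<Sigma> \<rho> *\<^sub>R ?I \<rho> \<partial>\<nu>) = (\<integral>\<rho>. ?I \<rho> \<partial>\<nu>)"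
      proof (rule integral_cong_AE)
        show "AE \<rho> in \<nu>. indicator ?\<Sigma> \<rho> *\<^sub>R ?I \<rho> = ?I \<rho>"
          using \<Sigma>_AE by eventually_elim simp
        show "(\<lambda>\<rho>. indicator ?\<Sigma> \<rho> *\<^sub>R ?I \<rho>) \<in> borel_measurable \<nu>"
          using \<Sigma>_sets \<nu>(2) I_meas by (intro borel_measurable_scaleR borel_measurable_indicator) auto
      qed (rule I_meas)
      also have "\<dots> = (\<integral>z. ?I (\<Phi> z) \<partial>M)"
        unfolding \<nu>_def by (intro integral_distr \<Phi>_meas measurable_signed_integral)
      also have "\<dots> = (\<integral>z. node_sum ?n f z \<partial>M)"
      proof (rule integral_cong_AE)
        show "AE z in M. ?I (\<Phi> z) = node_sum ?n f z"
          using M(3) by eventually_elim (simp add: \<Phi>_def signed_integral_node_measure)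
        show "(\<lambda>z. ?I (\<Phi> z)) \<in> borel_measurable M"
          by (rule measurable_compose[OF \<Phi>_meas measurable_signed_integral])
      qed (rule node_meas)
      finally show ?thesis unfolding M_int .
    qed
    ultimately show ?thesis
      unfolding set_integrable_def set_lebesgue_integral_def ind by simp
  qed
  show ?thesis
    by (intro exI[of _ \<nu>] conjI allI impI \<nu> null rep) (simp_all only: \<nu>(2) \<Sigma>_sets)
qed

end
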